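(* The category $\mathbf{CBCov}_i$ of inductively generated convergent covers (with convergent cover maps) is equivalent to the category of commutative co-semigroups in the symmetric monoidal category $\mathbf{BCov}_i$ of inductively generated basic covers.
   Context: A basic cover $\mathcal S=(S,\lhd)$ on a set $S$ is a relation $\lhd$ between elements and subsets of $S$ such that $a\in U$ implies $a\lhd U$, and $a\lhd U$, $U\lhd V$ imply $a\lhd V$, where $U\lhd V$ means $b\lhd V$ for all $b\in U$. Put $\mathcal A U=\{a\in S\mid a\lhd U\}$; $U=_{\mathcal A}V$ means $\mathcal A U=\mathcal A V$. $Sat(\mathcal A)=\{U\subseteq S\mid U=\mathcal A U\}$ has joins $\bigvee^{\mathcal A}_i\mathcal A U_i=\mathcal A(\bigcup_iU_i)$. Elements are identified with singletons. For a relation $r$ between $S$ and $T$ and $V\subseteq T$, $r^-V=\{a\in S\mid \exists b\in V,\ a\,r\,b\}$. A basic cover map $r:(S,\lhd_S)\to(T,\lhd_T)$ is a relation $r$ between $S$ and $T$ such that $b\lhd_TV$ implies $r^-b\lhd_Sr^-V$; two basic cover maps are equal if $r_1^-b=_{\mathcal A_S}r_2^-b$ for all $b\in T$. Composition is relational composition (so $(s\cdot r)^-=r^-s^-$). This gives the category $\mathbf{BCov}$. An axiom-set $(I,C)$ on $S$: sets $I(a)$ ($a\in S$) and subsets $C(a,i)\subseteq S$ ($i\in I(a)$). It generates the least basic cover $\lhd_{I,C}$ with $a\lhd C(a,i)$ for all $a,i$ (inductively defined by: $a\in U$ implies $a\lhd U$; $i\in I(a)$ and $C(a,i)\lhd U$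 imply $a\lhd U$). $\mathbf{BCov}_i$ is the full subcategory of $\mathbf{BCov}$ on the inductively generated basic covers, i.e. those of the form $\lhd_{I,C}$. Monoidal structure on $\mathbf{BCov}_i$: if $\mathcal S,\mathcal T$ are generated by $(I,C)$ and $(J,D)$, then $\mathcal S\otimes\mathcal T$ is the basic cover on $S\times T$ generated by the axioms $(a,b)\lhd C(a,i)\times\{b\}$ ($i\in I(a)$) and $(a,b)\lhd\{a\}\times D(b,j)$ ($j\in J(b)$). For morphisms, $r_1\otimes r_2$ is the unique morphism with $(r_1\otimes r_2)^-(b_1,b_2)=_{\mathcal A}(r_1^-b_1)\times(r_2^-b_2)$. The unit $E$ is the basic cover on $\{*\}$ generated by no axioms. The associativity isomorphism $\alpha:\mathcal S_1\otimes(\mathcal S_2\otimes\mathcal S_3)\to(\mathcal S_1\otimes\mathcal S_2)\otimes\mathcal S_3$ is determined by $\alpha^-((a_1,a_2),a_3)=_{\mathcal A}(a_1,(a_2,a_3))$, the symmetry $\gamma:\mathcal S_1\otimes\mathcal S_2\to\mathcal S_2\otimes\mathcal S_1$ by $\gamma^-(a_2,a_1)=_{\mathcal A}(a_1,a_2)$, and the unit isomorphisms are the obvious ones. A commutative co-semigroup in $\mathbf{BCov}_i$ is an object $\mathcal S$ with a morphism $\mu:\mathcal S\to\mathcal S\otimes\mathcal S$ such that $\alpha\cdot(id\otimes\mu)\cdot\mu=(\mu\otimes id)\cdot\mu$ and $\gamma\cdot\mu=\mu$. A morphism $(\mathcal S,\mu)\to(\mathcal S',\mu')$ is a basic cover map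 $r:\mathcal S\to\mathcal S'$ with $\mu'\cdot r=(r\otimes r)\cdot\mu$. A convergent cover is $(S,\lhd,\circ)$ where $\lhd$ is a basic cover on $S$ and $\circ$ is a binary operation on $\mathcal P(S)$ such that: $U_1\lhd V_1$ and $U_2\lhd V_2$ imply $U_1\circ U_2\lhd V_1\circ V_2$; $(U\circ V)\circ W\lhd U\circ(V\circ W)$; $U\circ V\lhd V\circ U$; and the operation $\mathcal A U\circ^{\mathcal A}\mathcal A V=\mathcal A(U\circ V)$ on $Sat(\mathcal A)$ distributes over arbitrary joins. Write $a\circ b=\{a\}\circ\{b\}$, etc. A convergent cover map $r:\mathcal S\to\mathcal T$ is a basic cover map with $r^-(b_1\circ_Tb_2)=_{\mathcal A}(r^-b_1)\circ_S(r^-b_2)$ for all $b_1,b_2\in T$; equality is that of basic cover maps. A convergent cover is inductively generated if it arises from some axiom-set $(I,C)$ on $S$ and map $\delta:S\times S\to\mathcal P(S)$ as follows: $U\circ V=\bigcup\{\delta(a,b)\mid a\in U,b\in V\}$, and $\lhd$ is the basic cover generated by the axiom-set $(J',D')$, where $(J,D)$ is $(I,C)$ plus the axioms $a\lhd c\circ b$ for $a\in b\circ c$ and $a\lhd b\circ(c\circ d)$ for $a\in(b\circ c)\circ d$, and $(J',D')$ is $(J,D)$ plus the axioms $a\lhd D(b,j)\circ c$ for $a\in b\circ c$, $j\in J(b)$. $\mathbf{CBCov}_i$ is the category of inductively generated convergent covers and convergent cover maps. *)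

theory Defs
  imports Main
begin

section \<open>Categories, functors, equivalences\<close>

text \<open>
  Hom-sets are indexed by objects and need not be disjoint; identities, composition and the
  arrow part of a functor therefore take the objects involved as arguments.
  \<open>Comp C X Y Z g f\<close> is \<open>g \<cdot> f\<close> for \<open>f : X \<rightarrow> Y\<close> and \<open>g : Y \<rightarrow> Z\<close>.
\<close>

record ('o, 'm) category =
  Ob :: "'o set"
  Hom :: "'o \<Rightarrow> 'o \<Rightarrow> 'm set"
  Idm :: "'o \<Rightarrow> 'm"
  Comp :: "'o \<Rightarrow> 'o \<Rightarrow> 'o \<Rightarrow> 'm \<Rightarrow> 'm \<Rightarrow> 'm"

definition is_category :: "('o, 'm, 'z) category_scheme \<Rightarrow> bool" where
  "is_category C \<longleftrightarrow>
     (\<forall>X\<in>Ob C. Idm C X \<in> Hom C X X) \<and>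
     (\<forall>X\<in>Ob C. \<forall>Y\<in>Ob C. \<forall>Z\<in>Ob C. \<forall>f\<in>Hom C X Y. \<forall>g\<in>Hom C Y Z.
        Comp C X Y Z g f \<in> Hom C X Z) \<and>
     (\<forall>X\<in>Ob C. \<forall>Y\<in>Ob C. \<forall>f\<in>Hom C X Y.
        Comp C X X Y f (Idm C X) = f \<and> Comp C X Y Y (Idm C Y) f = f) \<and>
     (\<forall>W\<in>Ob C. \<forall>X\<in>Ob C. \<forall>Y\<in>Ob C. \<forall>Z\<in>Ob C.
        \<forall>f\<in>Hom C W X. \<forall>g\<in>Hom C X Y. \<forall>h\<in>Hom C Y Z.
        Comp C W Y Z h (Comp C W X Y g f) = Comp C W X Z (Comp C X Y Z h g) f)"

definition is_functor ::
  "('o, 'm, 'z) category_scheme \<Rightarrow> ('p, 'n, 'y) category_scheme \<Rightarrow>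
   ('o \<Rightarrow> 'p) \<Rightarrow> ('o \<Rightarrow> 'o \<Rightarrow> 'm \<Rightarrow> 'n) \<Rightarrow> bool" where
  "is_functor C D Fo Fm \<longleftrightarrow>
     (\<forall>X\<in>Ob C. Fo X \<in> Ob D) \<and>
     (\<forall>X\<in>Ob C. \<forall>Y\<in>Ob C. \<forall>f\<in>Hom C X Y. Fm X Y f \<in> Hom D (Fo X) (Fo Y)) \<and>
     (\<forall>X\<in>Ob C. Fm X X (Idm C X) = Idm D (Fo X)) \<and>
     (\<forall>X\<in>Ob C. \<forall>Y\<in>Ob C. \<forall>Z\<in>Ob C. \<forall>f\<in>Hom C X Y. \<forall>g\<in>Hom C Y Z.
        Fm X Z (Comp C X Y Z g f) = Comp D (Fo X) (Fo Y) (Fo Z) (Fm Y Z g) (Fm X Y f))"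

definition is_iso :: "('o, 'm, 'z) category_scheme \<Rightarrow> 'o \<Rightarrow> 'o \<Rightarrow> 'm \<Rightarrow> bool" where
  "is_iso C X Y f \<longleftrightarrow> f \<in> Hom C X Y \<and>
     (\<exists>g\<in>Hom C Y X. Comp C X Y X g f = Idm C X \<and> Comp C Y X Y f g = Idm C Y)"

definition is_natural_iso ::
  "('o, 'm, 'z) category_scheme \<Rightarrow> ('p, 'n, 'y) category_scheme \<Rightarrow>
   ('o \<Rightarrow> 'p) \<Rightarrow> ('o \<Rightarrow> 'o \<Rightarrow> 'm \<Rightarrow> 'n) \<Rightarrow>
   ('o \<Rightarrow> 'p) \<Rightarrow> ('o \<Rightarrow> 'o \<Rightarrow> 'm \<Rightarrow> 'n) \<Rightarrow> ('o \<Rightarrow> 'n) \<Rightarrow> bool" where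
  "is_natural_iso C D Fo Fm Go Gm \<eta> \<longleftrightarrow>
     (\<forall>X\<in>Ob C. is_iso D (Fo X) (Go X) (\<eta> X)) \<and>
     (\<forall>X\<in>Ob C. \<forall>Y\<in>Ob C. \<forall>f\<in>Hom C X Y.
        Comp D (Fo X) (Fo Y) (Go Y) (\<eta> Y) (Fm X Y f) =
        Comp D (Fo X) (Go X) (Go Y) (Gm X Y f) (\<eta> X))"

definition equivalent_categories ::
  "('o, 'm, 'z) category_scheme \<Rightarrow> ('p, 'n, 'y) category_scheme \<Rightarrow> bool" where
  "equivalent_categories C D \<longleftrightarrow> is_category C \<and> is_category D \<and>
     (\<exists>Fo Fm Go Gm \<eta> \<epsilon>.
        is_functor C D Fo Fm \<and> is_functor D C Go Gm \<and>
        is_natural_iso C C (\<lambda>X. X) (\<lambda>X Y f. f)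
          (\<lambda>X. Go (Fo X)) (\<lambda>X Y f. Gm (Fo X) (Fo Y) (Fm X Y f)) \<eta> \<and>
        is_natural_iso D D (\<lambda>X. Fo (Go X)) (\<lambda>X Y f. Fm (Go X) (Go Y) (Gm X Y f))
          (\<lambda>X. X) (\<lambda>X Y f. f) \<epsilon>)"

section \<open>Commutative co-semigroups\<close>

text \<open>
  \<open>Assoc M X Y Z : X \<otimes> (Y \<otimes> Z) \<rightarrow> (X \<otimes> Y) \<otimes> Z\<close>,
  \<open>LUnit M X : E \<otimes> X \<rightarrow> X\<close>, \<open>RUnit M X : X \<otimes> E \<rightarrow> X\<close>,
  \<open>Sym M X Y : X \<otimes> Y \<rightarrow> Y \<otimes> X\<close>, and
  \<open>TensorM M X X' Y Y' f g : X \<otimes> Y \<rightarrow> X' \<otimes> Y'\<close> for \<open>f : X \<rightarrow> X'\<close>, \<open>g : Y \<rightarrow> Y'\<close>.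
\<close>

record ('o, 'm) sym_monoidal_category = "('o, 'm) category" +
  Tensor :: "'o \<Rightarrow> 'o \<Rightarrow> 'o"
  TensorM :: "'o \<Rightarrow> 'o \<Rightarrow> 'o \<Rightarrow> 'o \<Rightarrow> 'm \<Rightarrow> 'm \<Rightarrow> 'm"
  Unit :: "'o"
  Assoc :: "'o \<Rightarrow> 'o \<Rightarrow> 'o \<Rightarrow> 'm"
  LUnit :: "'o \<Rightarrow> 'm"
  RUnit :: "'o \<Rightarrow> 'm"
  Sym :: "'o \<Rightarrow> 'o \<Rightarrow> 'm"

definition comm_cosemigroup ::
  "('o, 'm, 'z) sym_monoidal_category_scheme \<Rightarrow> 'o \<Rightarrow> 'm \<Rightarrow> bool" where
  "comm_cosemigroup M X \<mu> \<longleftrightarrow>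
     (let X2 = Tensor M X X; L3 = Tensor M X2 X; R3 = Tensor M X X2 in
       X \<in> Ob M \<and> \<mu> \<in> Hom M X X2 \<and>
       Comp M X R3 L3 (Assoc M X X X) (Comp M X X2 R3 (TensorM M X X X X2 (Idm M X) \<mu>) \<mu>) =
         Comp M X X2 L3 (TensorM M X X2 X X \<mu> (Idm M X)) \<mu> \<and>
       Comp M X X2 X2 (Sym M X X) \<mu> = \<mu>)"

definition cosemigroup_map ::
  "('o, 'm, 'z) sym_monoidal_category_scheme \<Rightarrow> 'o \<Rightarrow> 'm \<Rightarrow> 'o \<Rightarrow> 'm \<Rightarrow> 'm \<Rightarrow> bool" where
  "cosemigroup_map M X \<mu> Y \<nu> f \<longleftrightarrow> f \<in> Hom M X Y \<and>
     Comp M X Y (Tensor M Y Y) \<nu> f =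
     Comp M X (Tensor M X X) (Tensor M Y Y) (TensorM M X Y X Y f f) \<mu>"

definition comm_cosemigroups ::
  "('o, 'm, 'z) sym_monoidal_category_scheme \<Rightarrow> ('o \<times> 'm, 'm) category" where
  "comm_cosemigroups M =
    \<lparr>Ob = {(X, \<mu>). comm_cosemigroup M X \<mu>},
     Hom = (\<lambda>(X, \<mu>) (Y, \<nu>). {f. cosemigroup_map M X \<mu> Y \<nu> f}),
     Idm = (\<lambda>(X, \<mu>). Idm M X),
     Comp = (\<lambda>(X, \<mu>) (Y, \<nu>) (Z, \<xi>). Comp M X Y Z)\<rparr>"

section \<open>Basic covers and basic cover maps\<close>

text \<open>
  A cover relation is \<open>False\<close> outside \<open>pts S \<times> Pow (pts S)\<close>, so that covers are equal as records
  exactly when they are equal as mathematical objects.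
\<close>

record 'a bcov =
  pts :: "'a set"
  cov :: "'a \<Rightarrow> 'a set \<Rightarrow> bool"

definition set_cov :: "'a bcov \<Rightarrow> 'a set \<Rightarrow> 'a set \<Rightarrow> bool" where
  "set_cov S U V \<longleftrightarrow> U \<subseteq> pts S \<and> V \<subseteq> pts S \<and> (\<forall>b\<in>U. cov S b V)"

definition basic_cover :: "'a bcov \<Rightarrow> bool" where
  "basic_cover S \<longleftrightarrow>
     (\<forall>a U. cov S a U \<longrightarrow> a \<in> pts S \<and> U \<subseteq> pts S) \<and>
     (\<forall>a U. U \<subseteq> pts S \<and> a \<in> U \<longrightarrow> cov S a U) \<and>
     (\<forall>a U V. cov S a U \<and> set_cov S U V \<longrightarrow> cov S a V)"

definition sat :: "'a bcov \<Rightarrow> 'a set \<Rightarrow> 'a set" where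
  "sat S U = {a \<in> pts S. cov S a U}"

definition Sat :: "'a bcov \<Rightarrow> 'a set set" where
  "Sat S = {U. U \<subseteq> pts S \<and> sat S U = U}"

definition bc_maps :: "'a bcov \<Rightarrow> 'b bcov \<Rightarrow> ('a \<times> 'b) set set" where
  "bc_maps S T = {r. r \<subseteq> pts S \<times> pts T \<and>
     (\<forall>b V. cov T b V \<longrightarrow> set_cov S (r\<inverse> `` {b}) (r\<inverse> `` V))}"

definition bc_eq :: "'a bcov \<Rightarrow> 'b bcov \<Rightarrow> (('a \<times> 'b) set \<times> ('a \<times> 'b) set) set" where
  "bc_eq S T = {(r, r'). r \<in> bc_maps S T \<and> r' \<in> bc_maps S T \<and>
     (\<forall>b\<in>pts T. sat S (r\<inverse> `` {b}) = sat S (r'\<inverse> `` {b}))}"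

text \<open>
  Morphisms are equality classes of maps, hence sets of relations. The classes of the composites
  \<open>r O s\<close> for representatives \<open>r\<close>, \<open>s\<close> all coincide, so the image below is that single class.
\<close>

definition bc_hom :: "'a bcov \<Rightarrow> 'b bcov \<Rightarrow> ('a \<times> 'b) set set set" where
  "bc_hom S T = bc_maps S T // bc_eq S T"

definition bc_id :: "'a bcov \<Rightarrow> ('a \<times> 'a) set set" where
  "bc_id S = bc_eq S S `` {Id_on (pts S)}"

definition bc_comp :: "'a bcov \<Rightarrow> 'b bcov \<Rightarrow> 'c bcov \<Rightarrow>
    ('b \<times> 'c) set set \<Rightarrow> ('a \<times> 'b) set set \<Rightarrow> ('a \<times> 'c) set set" where
  "bc_comp S T U Q R = bc_eq S U `` {r O q | r q. r \<in> R \<and> q \<in> Q}"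

section \<open>Inductively generated basic covers\<close>

definition axiom_set :: "'a set \<Rightarrow> ('a \<Rightarrow> 'i set) \<Rightarrow> ('a \<Rightarrow> 'i \<Rightarrow> 'a set) \<Rightarrow> bool" where
  "axiom_set S I C \<longleftrightarrow> (\<forall>a\<in>S. \<forall>i\<in>I a. C a i \<subseteq> S)"

inductive gen_cov ::
  "'a set \<Rightarrow> ('a \<Rightarrow> 'i set) \<Rightarrow> ('a \<Rightarrow> 'i \<Rightarrow> 'a set) \<Rightarrow> 'a \<Rightarrow> 'a set \<Rightarrow> bool"
  for S I C where
  refl: "U \<subseteq> S \<Longrightarrow> a \<in> U \<Longrightarrow> gen_cov S I C a U"
| infinity: "U \<subseteq> S \<Longrightarrow> a \<in> S \<Longrightarrow> i \<in> I a \<Longrightarrow> \<forall>b\<in>C a i. gen_cov S I C b U \<Longrightarrow> gen_cov S I C a U"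

definition gen_cover :: "'a set \<Rightarrow> ('a \<Rightarrow> 'i set) \<Rightarrow> ('a \<Rightarrow> 'i \<Rightarrow> 'a set) \<Rightarrow> 'a bcov" where
  "gen_cover S I C = \<lparr>pts = S, cov = gen_cov S I C\<rparr>"

text \<open>
  Indices may be taken of type \<^typ>\<open>'a set\<close>: an arbitrary axiom-set can be re-indexed by the
  subsets \<open>C a i\<close> themselves, see \<open>gen_cover_inductively_generated\<close> below.
\<close>

definition inductively_generated :: "'a bcov \<Rightarrow> bool" where
  "inductively_generated S \<longleftrightarrow>
     (\<exists>(I :: 'a \<Rightarrow> 'a set set) C. axiom_set (pts S) I C \<and> S = gen_cover (pts S) I C)"

lemma gen_cov_sub: "gen_cov S I C a U \<Longrightarrow> a \<in> S \<and> U \<subseteq> S"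
  by (induction rule: gen_cov.induct) auto

lemma gen_cov_trans:
  "gen_cov S I C a U \<Longrightarrow> V \<subseteq> S \<Longrightarrow> \<forall>b\<in>U. gen_cov S I C b V \<Longrightarrow> gen_cov S I C a V"
proof (induction rule: gen_cov.induct)
  case (refl U a)
  then show ?case by blast
next
  case (infinity U a i)
  then have "\<forall>b\<in>C a i. gen_cov S I C b V" by blast
  then show ?case by (rule gen_cov.infinity[where I = I and C = C, OF infinity.prems(1) infinity.hyps(2,3)])
qed

lemma basic_cover_gen_cover: "basic_cover (gen_cover S I C)"
  unfolding basic_cover_def
proof (intro conjI allI impI)
  fix a U assume "cov (gen_cover S I C) a U"
  then have "gen_cov S I C a U" by (simp add: gen_cover_def)
  from gen_cov_sub[OF this] show "a \<in> pts (gen_cover S I C)" "U \<subseteq> pts (gen_cover S I C)"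
    by (simp_all add: gen_cover_def)
next
  fix a U assume "U \<subseteq> pts (gen_cover S I C) \<and> a \<in> U"
  then show "cov (gen_cover S I C) a U" by (simp add: gen_cover_def gen_cov.refl)
next
  fix a U V assume "cov (gen_cover S I C) a U \<and> set_cov (gen_cover S I C) U V"
  then have "gen_cov S I C a U" "V \<subseteq> S" "\<forall>b\<in>U. gen_cov S I C b V"
    by (simp_all add: gen_cover_def set_cov_def)
  from gen_cov_trans[OF this] show "cov (gen_cover S I C) a V" by (simp add: gen_cover_def)
qed

lemma gen_cov_least:
  assumes "basic_cover T" "pts T = S"
    and "\<And>a i. a \<in> S \<Longrightarrow> i \<in> I a \<Longrightarrow> C a i \<subseteq> S \<and> cov T a (C a i)"
    and "gen_cov S I C a U"
  shows "cov T a U"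
  using assms(4)
proof (induction rule: gen_cov.induct)
  case (refl U a)
  then show ?case using assms(1,2) unfolding basic_cover_def by blast
next
  case (infinity U a i)
  have ax: "C a i \<subseteq> S" "cov T a (C a i)" using assms(3) infinity.hyps by blast+
  then have "set_cov T (C a i) U" using assms(2) infinity by (simp add: set_cov_def)
  then show ?case using assms(1) ax(2) unfolding basic_cover_def by blast
qed

lemma gen_cov_axiom:
  assumes "axiom_set S I C" "a \<in> S" "i \<in> I a"
  shows "gen_cov S I C a (C a i)"
proof -
  have sub: "C a i \<subseteq> S" using assms by (simp add: axiom_set_def)
  then have "\<forall>b\<in>C a i. gen_cov S I C b (C a i)" by (simp add: gen_cov.refl)
  then show ?thesis by (rule gen_cov.infinity[where I = I and C = C, OF sub assms(2,3)])
qed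

lemma gen_cover_mono:
  assumes "\<And>a. a \<in> S \<Longrightarrow> C a ` I a \<subseteq> C' a ` I' a" and "gen_cov S I C a U"
  shows "gen_cov S I' C' a U"
  using assms(2)
proof (induction rule: gen_cov.induct)
  case (refl U a)
  then show ?case by (rule gen_cov.refl)
next
  case (infinity U a i)
  then have "C a i \<in> C' a ` I' a" using assms(1)[of a] by blast
  then obtain i' where "i' \<in> I' a" "C' a i' = C a i" by (metis imageE)
  then have "\<forall>b\<in>C' a i'. gen_cov S I' C' b U" using infinity.IH by simp
  then show ?case by (rule gen_cov.infinity[where I = I' and C = C', OF infinity.hyps(1,2) \<open>i' \<in> I' a\<close>])
qed

lemma gen_cover_cong:
  assumes "\<And>a. a \<in> S \<Longrightarrow> C a ` I a = C' a ` I' a"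
  shows "gen_cover S I C = gen_cover S I' C'"
proof -
  have "gen_cov S I C a U \<longleftrightarrow> gen_cov S I' C' a U" for a U
  proof
    assume "gen_cov S I C a U"
    show "gen_cov S I' C' a U"
      by (rule gen_cover_mono[OF _ \<open>gen_cov S I C a U\<close>]) (rule equalityD1[OF assms])
  next
    assume "gen_cov S I' C' a U"
    show "gen_cov S I C a U"
      by (rule gen_cover_mono[OF _ \<open>gen_cov S I' C' a U\<close>]) (rule equalityD2[OF assms])
  qed
  then have "gen_cov S I C = gen_cov S I' C'" by (intro ext)
  then show ?thesis by (simp only: gen_cover_def)
qed

lemma gen_cover_inductively_generated:
  assumes "axiom_set S I C"
  shows "inductively_generated (gen_cover S I C)"
proof -
  have "gen_cover S I C = gen_cover S (\<lambda>a. C a ` I a) (\<lambda>a U. U)"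
    by (rule gen_cover_cong) simp
  moreover have "axiom_set S (\<lambda>a. C a ` I a) (\<lambda>a U. U)"
    using assms by (auto simp: axiom_set_def)
  moreover have "pts (gen_cover S I C) = S" by (simp add: gen_cover_def)
  ultimately show ?thesis unfolding inductively_generated_def by metis
qed

section \<open>The symmetric monoidal category of inductively generated basic covers\<close>

text \<open>
  The carriers of \<open>BCov_i\<close> range over the subsets of one fixed type, which has to be closed under
  the formation of pairs and contain the point of the unit object. \<open>'a elem\<close> is the closure
  of an arbitrary type under these; \<open>Pr a b\<close> plays the role of \<open>(a, b)\<close>.
\<close>

datatype 'a elem = Atom 'a | Point | Pr "'a elem" "'a elem"

definition pairs :: "'a elem set \<Rightarrow> 'a elem set \<Rightarrow> 'a elem set" where
  "pairs U V = {Pr a b | a b. a \<in> U \<and> b \<in> V}"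

fun tensor_I :: "('a elem \<Rightarrow> 'i set) \<Rightarrow> ('a elem \<Rightarrow> 'j set) \<Rightarrow> 'a elem \<Rightarrow> ('i + 'j) set" where
  "tensor_I I J (Pr a b) = I a <+> J b"
| "tensor_I I J _ = {}"

fun tensor_C :: "('a elem \<Rightarrow> 'i \<Rightarrow> 'a elem set) \<Rightarrow> ('a elem \<Rightarrow> 'j \<Rightarrow> 'a elem set) \<Rightarrow>
    'a elem \<Rightarrow> 'i + 'j \<Rightarrow> 'a elem set" where
  "tensor_C C D (Pr a b) (Inl i) = pairs (C a i) {b}"
| "tensor_C C D (Pr a b) (Inr j) = pairs {a} (D b j)"
| "tensor_C C D _ _ = {}"

definition gen_tensor :: "'a elem set \<Rightarrow> ('a elem \<Rightarrow> 'i set) \<Rightarrow> ('a elem \<Rightarrow> 'i \<Rightarrow> 'a elem set) \<Rightarrow>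
    'a elem set \<Rightarrow> ('a elem \<Rightarrow> 'j set) \<Rightarrow> ('a elem \<Rightarrow> 'j \<Rightarrow> 'a elem set) \<Rightarrow> 'a elem bcov" where
  "gen_tensor S I C T J D = gen_cover (pairs S T) (tensor_I I J) (tensor_C C D)"

text \<open>The tensor product does not depend on the generating axiom-sets: see \<open>tensor_gen_cover\<close>.\<close>

definition tensor :: "'a elem bcov \<Rightarrow> 'a elem bcov \<Rightarrow> 'a elem bcov" where
  "tensor S T = (THE W. \<exists>(I :: 'a elem \<Rightarrow> 'a elem set set) C (J :: 'a elem \<Rightarrow> 'a elem set set) D.
     axiom_set (pts S) I C \<and> S = gen_cover (pts S) I C \<and>
     axiom_set (pts T) J D \<and> T = gen_cover (pts T) J D \<and>
     W = gen_tensor (pts S) I C (pts T) J D)"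

lemma gen_tensor_left:
  assumes "axiom_set S I C" and "gen_cov S I C a U" and "b \<in> T"
  shows "gen_cov (pairs S T) (tensor_I I J) (tensor_C C D) (Pr a b) (pairs U {b})"
  using assms(2)
proof (induction rule: gen_cov.induct)
  case (refl U a)
  then show ?case using assms(3) by (auto simp: pairs_def intro!: gen_cov.refl)
next
  case (infinity U a i)
  then show ?case using assms(3)
    by (intro gen_cov.infinity[of _ _ _ "Inl i"]) (auto simp: pairs_def)
qed

lemma gen_tensor_right:
  assumes "axiom_set T J D" and "gen_cov T J D b V" and "a \<in> S"
  shows "gen_cov (pairs S T) (tensor_I I J) (tensor_C C D) (Pr a b) (pairs {a} V)"
  using assms(2)
proof (induction rule: gen_cov.induct)
  case (refl V b)
  then show ?case using assms(3) by (auto simp: pairs_def intro!: gen_cov.refl)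
next
  case (infinity V b j)
  then show ?case using assms(3)
    by (intro gen_cov.infinity[of _ _ _ "Inr j"]) (auto simp: pairs_def)
qed

lemma gen_tensor_le:
  assumes ax: "axiom_set S I C" "axiom_set T J D" "axiom_set S I' C'" "axiom_set T J' D'"
    and eq: "gen_cover S I C = gen_cover S I' C'" "gen_cover T J D = gen_cover T J' D'"
    and x: "gen_cov (pairs S T) (tensor_I I J) (tensor_C C D) x W"
  shows "gen_cov (pairs S T) (tensor_I I' J') (tensor_C C' D') x W"
proof -
  let ?T = "gen_tensor S I' C' T J' D'"
  have eq': "gen_cov S I C = gen_cov S I' C'" "gen_cov T J D = gen_cov T J' D'"
    using eq by (simp_all add: gen_cover_def)
  have "cov ?T x W"
  proof (rule gen_cov_least[OF _ _ _ x])
    show "basic_cover ?T" by (simp add: gen_tensor_def basic_cover_gen_cover)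
    show "pts ?T = pairs S T" by (simp add: gen_tensor_def gen_cover_def)
    fix y k assume "y \<in> pairs S T" and k: "k \<in> tensor_I I J y"
    then obtain a b where y: "y = Pr a b" "a \<in> S" "b \<in> T" by (auto simp: pairs_def)
    show "tensor_C C D y k \<subseteq> pairs S T \<and> cov ?T y (tensor_C C D y k)"
    proof (cases k)
      case (Inl i)
      then have i: "i \<in> I a" using k y by auto
      have "gen_cov S I' C' a (C a i)" using gen_cov_axiom[OF ax(1) y(2) i] eq' by simp
      from gen_tensor_left[OF ax(3) this y(3)]
      have "cov ?T y (tensor_C C D y k)" using y Inl by (simp add: gen_tensor_def gen_cover_def)
      moreover have "C a i \<subseteq> S" using ax(1) i y by (simp add: axiom_set_def)
      then have "tensor_C C D y k \<subseteq> pairs S T" using y Inl by (auto simp: pairs_def)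
      ultimately show ?thesis by simp
    next
      case (Inr j)
      then have j: "j \<in> J b" using k y by auto
      have "gen_cov T J' D' b (D b j)" using gen_cov_axiom[OF ax(2) y(3) j] eq' by simp
      from gen_tensor_right[OF ax(4) this y(2)]
      have "cov ?T y (tensor_C C D y k)" using y Inr by (simp add: gen_tensor_def gen_cover_def)
      moreover have "D b j \<subseteq> T" using ax(2) j y by (simp add: axiom_set_def)
      then have "tensor_C C D y k \<subseteq> pairs S T" using y Inr by (auto simp: pairs_def)
      ultimately show ?thesis by simp
    qed
  qed
  then show ?thesis by (simp add: gen_tensor_def gen_cover_def)
qed

lemma gen_tensor_cong:
  assumes "axiom_set S I C" "axiom_set T J D" "axiom_set S I' C'" "axiom_set T J' D'"
    and "gen_cover S I C = gen_cover S I' C'" "gen_cover T J D = gen_cover T J' D'"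
  shows "gen_tensor S I C T J D = gen_tensor S I' C' T J' D'"
  using gen_tensor_le[OF assms(1-4) assms(5,6)]
    gen_tensor_le[OF assms(3,4,1,2) assms(5,6)[symmetric]]
  by (auto simp: gen_tensor_def gen_cover_def fun_eq_iff)

lemma tensor_gen_cover:
  assumes ax: "axiom_set S I C" "axiom_set T J D"
  shows "tensor (gen_cover S I C) (gen_cover T J D) = gen_tensor S I C T J D"
proof -
  have p: "pts (gen_cover S I C) = S" "pts (gen_cover T J D) = T"
    by (simp_all add: gen_cover_def)
  obtain I0 :: "'a elem \<Rightarrow> 'a elem set set" and C0 where
    0: "axiom_set S I0 C0" "gen_cover S I C = gen_cover S I0 C0"
    using gen_cover_inductively_generated[OF ax(1)] unfolding inductively_generated_def p by blast
  obtain J0 :: "'a elem \<Rightarrow> 'a elem set set" and D0 where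
    1: "axiom_set T J0 D0" "gen_cover T J D = gen_cover T J0 D0"
    using gen_cover_inductively_generated[OF ax(2)] unfolding inductively_generated_def p by blast
  show ?thesis unfolding tensor_def p
  proof (rule the_equality)
    show "\<exists>(I' :: 'a elem \<Rightarrow> 'a elem set set) C' (J' :: 'a elem \<Rightarrow> 'a elem set set) D'.
        axiom_set S I' C' \<and> gen_cover S I C = gen_cover S I' C' \<and>
        axiom_set T J' D' \<and> gen_cover T J D = gen_cover T J' D' \<and>
        gen_tensor S I C T J D = gen_tensor S I' C' T J' D'"
      using 0 1 gen_tensor_cong[OF ax 0(1) 1(1) 0(2) 1(2)] by blast
  next
    fix W
    assume "\<exists>(I' :: 'a elem \<Rightarrow> 'a elem set set) C' (J' :: 'a elem \<Rightarrow> 'a elem set set) D'.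
        axiom_set S I' C' \<and> gen_cover S I C = gen_cover S I' C' \<and>
        axiom_set T J' D' \<and> gen_cover T J D = gen_cover T J' D' \<and>
        W = gen_tensor S I' C' T J' D'"
    then obtain I' :: "'a elem \<Rightarrow> 'a elem set set" and C'
        and J' :: "'a elem \<Rightarrow> 'a elem set set" and D' where
      "axiom_set S I' C'" "gen_cover S I C = gen_cover S I' C'"
      "axiom_set T J' D'" "gen_cover T J D = gen_cover T J' D'"
      "W = gen_tensor S I' C' T J' D'" by blast
    then show "W = gen_tensor S I C T J D"
      using gen_tensor_cong[OF ax, of I' C' J' D'] by simp
  qed
qed

text \<open>
  As morphisms are equality classes, ``the unique morphism such that \dots'' is the set of all
  basic cover maps with the property in question.
\<close>

definition tensor_mor :: "'a elem bcov \<Rightarrow> 'a elem bcov \<Rightarrow> 'a elem bcov \<Rightarrow> 'a elem bcov \<Rightarrow>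
    ('a elem \<times> 'a elem) set set \<Rightarrow> ('a elem \<times> 'a elem) set set \<Rightarrow> ('a elem \<times> 'a elem) set set" where
  "tensor_mor S1 T1 S2 T2 R1 R2 = {r \<in> bc_maps (tensor S1 S2) (tensor T1 T2).
     \<exists>r1\<in>R1. \<exists>r2\<in>R2. \<forall>b1\<in>pts T1. \<forall>b2\<in>pts T2.
       sat (tensor S1 S2) (r\<inverse> `` {Pr b1 b2}) =
       sat (tensor S1 S2) (pairs (r1\<inverse> `` {b1}) (r2\<inverse> `` {b2}))}"

definition unit_cover :: "'a elem bcov" where
  "unit_cover = gen_cover {Point} (\<lambda>_. {} :: unit set) (\<lambda>_ _. {})"

definition assoc_mor ::
  "'a elem bcov \<Rightarrow> 'a elem bcov \<Rightarrow> 'a elem bcov \<Rightarrow> ('a elem \<times> 'a elem) set set" where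
  "assoc_mor S1 S2 S3 = {r \<in> bc_maps (tensor S1 (tensor S2 S3)) (tensor (tensor S1 S2) S3).
     \<forall>a1\<in>pts S1. \<forall>a2\<in>pts S2. \<forall>a3\<in>pts S3.
       sat (tensor S1 (tensor S2 S3)) (r\<inverse> `` {Pr (Pr a1 a2) a3}) =
       sat (tensor S1 (tensor S2 S3)) {Pr a1 (Pr a2 a3)}}"

definition sym_mor :: "'a elem bcov \<Rightarrow> 'a elem bcov \<Rightarrow> ('a elem \<times> 'a elem) set set" where
  "sym_mor S1 S2 = {r \<in> bc_maps (tensor S1 S2) (tensor S2 S1).
     \<forall>a1\<in>pts S1. \<forall>a2\<in>pts S2.
       sat (tensor S1 S2) (r\<inverse> `` {Pr a2 a1}) = sat (tensor S1 S2) {Pr a1 a2}}"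

definition lunit_mor :: "'a elem bcov \<Rightarrow> ('a elem \<times> 'a elem) set set" where
  "lunit_mor S = {r \<in> bc_maps (tensor unit_cover S) S.
     \<forall>a\<in>pts S. sat (tensor unit_cover S) (r\<inverse> `` {a}) = sat (tensor unit_cover S) {Pr Point a}}"

definition runit_mor :: "'a elem bcov \<Rightarrow> ('a elem \<times> 'a elem) set set" where
  "runit_mor S = {r \<in> bc_maps (tensor S unit_cover) S.
     \<forall>a\<in>pts S. sat (tensor S unit_cover) (r\<inverse> `` {a}) = sat (tensor S unit_cover) {Pr a Point}}"

definition BCov_i ::
  "('a elem bcov, ('a elem \<times> 'a elem) set set) sym_monoidal_category" where
  "BCov_i =
    \<lparr>Ob = {S. inductively_generated S},
     Hom = bc_hom,
     Idm = bc_id,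
     Comp = bc_comp,
     Tensor = tensor,
     TensorM = tensor_mor,
     Unit = unit_cover,
     Assoc = assoc_mor,
     LUnit = lunit_mor,
     RUnit = runit_mor,
     Sym = sym_mor\<rparr>"

section \<open>Convergent covers\<close>

text \<open>The operation is normalised to the empty set on arguments that are not subsets of the carrier.\<close>

record 'a ccov =
  cover :: "'a bcov"
  cop :: "'a set \<Rightarrow> 'a set \<Rightarrow> 'a set"

abbreviation cpts :: "'a ccov \<Rightarrow> 'a set" where
  "cpts K \<equiv> pts (cover K)"

definition sat_op :: "'a ccov \<Rightarrow> 'a set \<Rightarrow> 'a set \<Rightarrow> 'a set" where
  "sat_op K X Y = sat (cover K) (cop K X Y)"

definition sat_join :: "'a bcov \<Rightarrow> 'a set set \<Rightarrow> 'a set" where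
  "sat_join S \<X> = sat S (\<Union>\<X>)"

definition convergent_cover :: "'a ccov \<Rightarrow> bool" where
  "convergent_cover K \<longleftrightarrow>
     basic_cover (cover K) \<and>
     (\<forall>U V. cop K U V \<subseteq> cpts K) \<and>
     (\<forall>U V. \<not> (U \<subseteq> cpts K \<and> V \<subseteq> cpts K) \<longrightarrow> cop K U V = {}) \<and>
     (\<forall>U1 V1 U2 V2. set_cov (cover K) U1 V1 \<and> set_cov (cover K) U2 V2 \<longrightarrow>
        set_cov (cover K) (cop K U1 U2) (cop K V1 V2)) \<and>
     (\<forall>U V W. U \<subseteq> cpts K \<and> V \<subseteq> cpts K \<and> W \<subseteq> cpts K \<longrightarrow>
        set_cov (cover K) (cop K (cop K U V) W) (cop K U (cop K V W))) \<and>
     (\<forall>U V. U \<subseteq> cpts K \<and> V \<subseteq> cpts K \<longrightarrow> set_cov (cover K) (cop K U V) (cop K V U)) \<and>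
     (\<forall>X\<in>Sat (cover K). \<forall>\<Y>\<subseteq>Sat (cover K).
        sat_op K X (sat_join (cover K) \<Y>) = sat_join (cover K) {sat_op K X Y | Y. Y \<in> \<Y>} \<and>
        sat_op K (sat_join (cover K) \<Y>) X = sat_join (cover K) {sat_op K Y X | Y. Y \<in> \<Y>})"

definition cc_maps :: "'a ccov \<Rightarrow> 'b ccov \<Rightarrow> ('a \<times> 'b) set set" where
  "cc_maps K L = {r \<in> bc_maps (cover K) (cover L). \<forall>b1\<in>cpts L. \<forall>b2\<in>cpts L.
     sat (cover K) (r\<inverse> `` cop L {b1} {b2}) = sat (cover K) (cop K (r\<inverse> `` {b1}) (r\<inverse> `` {b2}))}"

definition delta_op :: "('a \<Rightarrow> 'a \<Rightarrow> 'a set) \<Rightarrow> 'a set \<Rightarrow> 'a set \<Rightarrow> 'a set" where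
  "delta_op \<delta> U V = (\<Union>a\<in>U. \<Union>b\<in>V. \<delta> a b)"

text \<open>
  \<open>(conv_J, conv_D)\<close> extends \<open>(I, C)\<close> by the axioms \<open>a \<lhd> c \<circ> b\<close> for \<open>a \<in> b \<circ> c\<close> (index
  \<open>CommAx b c\<close>) and \<open>a \<lhd> b \<circ> (c \<circ> d)\<close> for \<open>a \<in> (b \<circ> c) \<circ> d\<close> (index \<open>AssocAx b c d\<close>);
  \<open>(stab_J, stab_D)\<close> extends \<open>(J, D)\<close> by \<open>a \<lhd> D(b,j) \<circ> c\<close> for \<open>a \<in> b \<circ> c\<close> and
  \<open>j \<in> J(b)\<close> (index \<open>StabAx b c j\<close>).
\<close>

datatype ('a, 'i) conv_index = Orig 'i | CommAx 'a 'a | AssocAx 'a 'a 'a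

datatype ('a, 'j) stab_index = Base 'j | StabAx 'a 'a 'j

definition conv_J :: "'a set \<Rightarrow> ('a \<Rightarrow> 'a \<Rightarrow> 'a set) \<Rightarrow> ('a \<Rightarrow> 'i set) \<Rightarrow>
    'a \<Rightarrow> ('a, 'i) conv_index set" where
  "conv_J S \<delta> I a = Orig ` I a
     \<union> {CommAx b c | b c. b \<in> S \<and> c \<in> S \<and> a \<in> \<delta> b c}
     \<union> {AssocAx b c d | b c d. b \<in> S \<and> c \<in> S \<and> d \<in> S \<and> a \<in> delta_op \<delta> (\<delta> b c) {d}}"

fun conv_D :: "('a \<Rightarrow> 'a \<Rightarrow> 'a set) \<Rightarrow> ('a \<Rightarrow> 'i \<Rightarrow> 'a set) \<Rightarrow>
    'a \<Rightarrow> ('a, 'i) conv_index \<Rightarrow> 'a set" where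
  "conv_D \<delta> C a (Orig i) = C a i"
| "conv_D \<delta> C a (CommAx b c) = \<delta> c b"
| "conv_D \<delta> C a (AssocAx b c d) = delta_op \<delta> {b} (\<delta> c d)"

definition stab_J :: "'a set \<Rightarrow> ('a \<Rightarrow> 'a \<Rightarrow> 'a set) \<Rightarrow> ('a \<Rightarrow> 'j set) \<Rightarrow>
    'a \<Rightarrow> ('a, 'j) stab_index set" where
  "stab_J S \<delta> J a = Base ` J a
     \<union> {StabAx b c j | b c j. b \<in> S \<and> c \<in> S \<and> a \<in> \<delta> b c \<and> j \<in> J b}"

fun stab_D :: "('a \<Rightarrow> 'a \<Rightarrow> 'a set) \<Rightarrow> ('a \<Rightarrow> 'j \<Rightarrow> 'a set) \<Rightarrow>
    'a \<Rightarrow> ('a, 'j) stab_index \<Rightarrow> 'a set" where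
  "stab_D \<delta> D a (Base j) = D a j"
| "stab_D \<delta> D a (StabAx b c j) = delta_op \<delta> (D b j) {c}"

definition gen_conv_cover :: "'a set \<Rightarrow> ('a \<Rightarrow> 'i set) \<Rightarrow> ('a \<Rightarrow> 'i \<Rightarrow> 'a set) \<Rightarrow>
    ('a \<Rightarrow> 'a \<Rightarrow> 'a set) \<Rightarrow> 'a ccov" where
  "gen_conv_cover S I C \<delta> =
    \<lparr>cover = gen_cover S (stab_J S \<delta> (conv_J S \<delta> I)) (stab_D \<delta> (conv_D \<delta> C)),
     cop = (\<lambda>U V. if U \<subseteq> S \<and> V \<subseteq> S then delta_op \<delta> U V else {})\<rparr>"

text \<open>
  The index type is again no restriction, see \<open>gen_conv_cover_reindex\<close>.
\<close>

definition inductively_generated_cc :: "'a ccov \<Rightarrow> bool" where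
  "inductively_generated_cc K \<longleftrightarrow>
     (\<exists>(I :: 'a \<Rightarrow> 'a set set) C \<delta>. axiom_set (cpts K) I C \<and>
        (\<forall>a\<in>cpts K. \<forall>b\<in>cpts K. \<delta> a b \<subseteq> cpts K) \<and> K = gen_conv_cover (cpts K) I C \<delta>)"

lemma image_Collect2: "f ` {g b c | b c. P b c} = {f (g b c) | b c. P b c}"
  by blast

lemma image_Collect3: "f ` {g b c d | b c d. P b c d} = {f (g b c d) | b c d. P b c d}"
  by blast

lemma conv_D_image:
  "conv_D \<delta> C a ` conv_J S \<delta> I a = C a ` I a
     \<union> {\<delta> c b | b c. b \<in> S \<and> c \<in> S \<and> a \<in> \<delta> b c}
     \<union> {delta_op \<delta> {b} (\<delta> c d) | b c d. b \<in> S \<and> c \<in> S \<and> d \<in> S \<and> a \<in> delta_op \<delta> (\<delta> b c) {d}}"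
  by (simp only: conv_J_def image_Un image_image image_Collect2 image_Collect3 conv_D.simps)

lemma stab_D_image:
  "stab_D \<delta> D a ` stab_J S \<delta> J a = D a ` J a
     \<union> {delta_op \<delta> U {c} | b c U. b \<in> S \<and> c \<in> S \<and> a \<in> \<delta> b c \<and> U \<in> D b ` J b}"
proof -
  have "{delta_op \<delta> (D b j) {c} | b c j. b \<in> S \<and> c \<in> S \<and> a \<in> \<delta> b c \<and> j \<in> J b}
      = {delta_op \<delta> U {c} | b c U. b \<in> S \<and> c \<in> S \<and> a \<in> \<delta> b c \<and> U \<in> D b ` J b}"
    by blast
  then show ?thesis
    by (simp only: stab_J_def image_Un image_image image_Collect3 stab_D.simps)
qed

lemma gen_conv_cover_reindex:
  "gen_conv_cover S I C \<delta> = gen_conv_cover S (\<lambda>a. C a ` I a) (\<lambda>a U. U) \<delta>"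
proof -
  have "conv_D \<delta> C a ` conv_J S \<delta> I a =
      conv_D \<delta> (\<lambda>a U. U) a ` conv_J S \<delta> (\<lambda>a. C a ` I a) a" for a
    unfolding conv_D_image by simp
  then have "gen_cover S (stab_J S \<delta> (conv_J S \<delta> I)) (stab_D \<delta> (conv_D \<delta> C)) =
      gen_cover S (stab_J S \<delta> (conv_J S \<delta> (\<lambda>a. C a ` I a))) (stab_D \<delta> (conv_D \<delta> (\<lambda>a U. U)))"
    by (intro gen_cover_cong) (simp only: stab_D_image)
  then show ?thesis by (simp add: gen_conv_cover_def)
qed

definition CBCov_i :: "('a elem ccov, ('a elem \<times> 'a elem) set set) category" where
  "CBCov_i =
    \<lparr>Ob = {K. convergent_cover K \<and> inductively_generated_cc K},
     Hom = (\<lambda>K L. cc_maps K L // bc_eq (cover K) (cover L)),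
     Idm = (\<lambda>K. bc_id (cover K)),
     Comp = (\<lambda>K L M. bc_comp (cover K) (cover L) (cover M))\<rparr>"

end

theory Submission
  imports Defs
begin

text \<open>
  A morphism \<open>R : S \<rightarrow> T\<close> of basic covers is determined by its inverse image operation
  \<open>V \<mapsto> \<A> (R\<^sup>- V)\<close>, written \<open>pre S R\<close> below. It depends on \<open>V\<close> only up to mutual covering,
  preserves unions up to saturation, is contravariantly functorial in \<open>R\<close>, and any assignment
  on points that sends covers to covers extends to such an operation. So equations between
  morphisms can be checked on single points of the target, and morphisms into a generated
  cover can be defined by checking the generating axioms.

  The axioms of \<open>S \<otimes> T\<close> say that covers of one coordinate are stable under fixing the other.
  Hence a morphism \<open>\<mu> : S \<rightarrow> S \<otimes> S\<close> amounts to an assignment \<open>(a, b) \<mapsto> \<A> (a \<circ> b)\<close> preserving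
  covers separately in \<open>a\<close> and in \<open>b\<close> (\<open>preserves_covers_tensorI\<close>). Reading the two sides of
  co-associativity at the point \<open>((a, b), c)\<close> gives \<open>a \<circ> (b \<circ> c)\<close> and \<open>(a \<circ> b) \<circ> c\<close>, and
  co-commutativity becomes \<open>a \<circ> b = b \<circ> a\<close> (\<open>comm_cosemigroup_iff\<close>). In the same way
  \<open>\<mu>' \<cdot> r = (r \<otimes> r) \<cdot> \<mu>\<close> reads
  \<open>r\<^sup>- (b \<circ> b') = r\<^sup>- b \<circ> r\<^sup>- b'\<close> (\<open>cosemigroup_map_iff\<close>), so that convergent cover maps and
  co-semigroup morphisms are the same arrows (\<open>cc_maps_class_iff_cosemigroup_map\<close>).

  Two observations take care of inductive generation. A basic cover is generated by the
  axiom-set of all its covers (\<open>basic_cover_eq_gen_cover\<close>). A convergent cover is inductively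
  generated iff its operation is determined by singletons through strict unions
  (\<open>inductively_generated_cc_iff_additive\<close>), because the axioms added to an
  axiom-set for \<open>\<circ>\<close> already hold in a convergent cover.

  Both functors are the identity on arrows. \<open>K \<mapsto> (cover K, comult K)\<close> and
  \<open>(X, \<mu>) \<mapsto> ccov_of X \<mu>\<close> compose to the identity on co-semigroups, while in the other order
  \<open>a \<circ> b\<close> is replaced by its saturation, which does not affect the arrows.
\<close>

section \<open>Equivalences that are the identity on arrows\<close>

text \<open>
  \<open>G (F X)\<close> may differ from \<open>X\<close>, but it has the same arrows, identity and composition, so the
  identity of \<open>X\<close> is itself an isomorphism between the two.
\<close>

lemma equivalence_identity_on_arrows:
  assumes C: "is_category C"
    and F: "\<And>X. X \<in> Ob C \<Longrightarrow> F X \<in> Ob D"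
    and G: "\<And>Y. Y \<in> Ob D \<Longrightarrow> G Y \<in> Ob C"
    and FG: "\<And>Y. Y \<in> Ob D \<Longrightarrow> F (G Y) = Y"
    and Hom: "\<And>X Y. X \<in> Ob C \<Longrightarrow> Y \<in> Ob C \<Longrightarrow> Hom D (F X) (F Y) = Hom C X Y"
    and Idm: "\<And>X. X \<in> Ob C \<Longrightarrow> Idm D (F X) = Idm C X"
    and Comp: "\<And>X Y Z. X \<in> Ob C \<Longrightarrow> Y \<in> Ob C \<Longrightarrow> Z \<in> Ob C \<Longrightarrow>
      Comp D (F X) (F Y) (F Z) = Comp C X Y Z"
  shows "equivalent_categories C D"
proof -
  have HomG: "Hom D X Y = Hom C (G X) (G Y)" if "X \<in> Ob D" "Y \<in> Ob D" for X Y
    using Hom[OF G G] FG that by metis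
  have IdmG: "Idm D X = Idm C (G X)" if "X \<in> Ob D" for X
    using Idm[OF G] FG that by metis
  have CompG: "Comp D X Y Z = Comp C (G X) (G Y) (G Z)"
    if "X \<in> Ob D" "Y \<in> Ob D" "Z \<in> Ob D" for X Y Z
    using Comp[OF G G G] FG that by metis
  have D: "is_category D"
    using C unfolding is_category_def by (simp add: HomG IdmG CompG G)
  have "is_functor C D F (\<lambda>X Y f. f)"
    unfolding is_functor_def by (simp add: F Hom Idm Comp)
  moreover have "is_functor D C G (\<lambda>X Y f. f)"
    unfolding is_functor_def by (simp add: G HomG IdmG CompG)
  moreover have "is_natural_iso C C (\<lambda>X. X) (\<lambda>X Y f. f) (\<lambda>X. G (F X)) (\<lambda>X Y f. f) (Idm C)"
  proof -
    \<comment> \<open>\<open>C\<close> does not distinguish \<open>G (F X)\<close> from \<open>X\<close>, as far as arrows are concerned.\<close>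
    have GF: "G (F X) \<in> Ob C" "Hom C X (G (F Y)) = Hom C X Y" "Hom C (G (F X)) Y = Hom C X Y"
      "Idm C (G (F X)) = Idm C X" if "X \<in> Ob C" "Y \<in> Ob C" for X Y
      using that F G FG Hom Idm by metis+
    have GF_Comp: "Comp C X Y (G (F Z)) = Comp C X Y Z" "Comp C X (G (F Y)) Z = Comp C X Y Z"
      "Comp C (G (F X)) Y Z = Comp C X Y Z"
      if "X \<in> Ob C" "Y \<in> Ob C" "Z \<in> Ob C" for X Y Z
      using that F G FG Comp by metis+
    show ?thesis
      using C unfolding is_natural_iso_def is_iso_def is_category_def
      by (auto simp: GF GF_Comp)
  qed
  moreover have "is_natural_iso D D (\<lambda>X. F (G X)) (\<lambda>X Y f. f) (\<lambda>X. X) (\<lambda>X Y f. f) (Idm D)"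
    using D unfolding is_natural_iso_def is_iso_def is_category_def by (auto simp: FG)
  ultimately show ?thesis
    using C D unfolding equivalent_categories_def by blast
qed

section \<open>Saturation\<close>

lemma sat_pts: "sat S U \<subseteq> pts S"
  by (auto simp: sat_def)

text \<open>
  The three clauses as separate rules: as rewrite rules they loop, since transitivity leaves the
  middle set undetermined.
\<close>

lemma
  assumes "basic_cover S"
  shows cov_pts: "cov S a U \<Longrightarrow> a \<in> pts S \<and> U \<subseteq> pts S"
    and cov_refl: "U \<subseteq> pts S \<Longrightarrow> a \<in> U \<Longrightarrow> cov S a U"
    and cov_trans: "cov S a U \<Longrightarrow> set_cov S U V \<Longrightarrow> cov S a V"
proof -
  note S = assms[unfolded basic_cover_def]
  show "cov S a U \<Longrightarrow> a \<in> pts S \<and> U \<subseteq> pts S"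
    by (rule S[THEN conjunct1, rule_format])
  show "U \<subseteq> pts S \<Longrightarrow> a \<in> U \<Longrightarrow> cov S a U"
    by (rule S[THEN conjunct2, THEN conjunct1, rule_format, OF conjI])
  show "cov S a U \<Longrightarrow> set_cov S U V \<Longrightarrow> cov S a V"
    by (rule S[THEN conjunct2, THEN conjunct2, rule_format, OF conjI])
qed

lemma cov_iff_sat: "basic_cover S \<Longrightarrow> cov S a V \<longleftrightarrow> V \<subseteq> pts S \<and> a \<in> sat S V"
  using cov_pts by (fastforce simp: sat_def)

lemma set_cov_iff_sat: "V \<subseteq> pts S \<Longrightarrow> set_cov S U V \<longleftrightarrow> U \<subseteq> sat S V" if "basic_cover S"
  using cov_pts[OF that] by (fastforce simp: sat_def set_cov_def)

lemma sat_self: "basic_cover S \<Longrightarrow> U \<subseteq> pts S \<Longrightarrow> U \<subseteq> sat S U"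
  by (auto simp: sat_def cov_refl)

lemma sat_subset_sat:
  assumes S: "basic_cover S" and V: "V \<subseteq> pts S" and UV: "U \<subseteq> sat S V"
  shows "sat S U \<subseteq> sat S V"
  using cov_trans[OF S] UV set_cov_iff_sat[OF S V] by (auto simp: sat_def)

lemma sat_mono: "basic_cover S \<Longrightarrow> U \<subseteq> V \<Longrightarrow> V \<subseteq> pts S \<Longrightarrow> sat S U \<subseteq> sat S V"
  by (rule sat_subset_sat[OF _ _ subset_trans[OF _ sat_self]])

lemma sat_sat: "basic_cover S \<Longrightarrow> U \<subseteq> pts S \<Longrightarrow> sat S (sat S U) = sat S U"
  by (rule subset_antisym[OF sat_subset_sat[OF _ _ order_refl] sat_self[OF _ sat_pts]])

lemma sat_eqI:
  "basic_cover S \<Longrightarrow> U \<subseteq> sat S V \<Longrightarrow> V \<subseteq> sat S U \<Longrightarrow> U \<subseteq> pts S \<Longrightarrow> V \<subseteq> pts S \<Longrightarrow> sat S U = sat S V"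
  by (rule subset_antisym[OF sat_subset_sat sat_subset_sat])

lemma sat_UN_sat:
  assumes "basic_cover S" "\<And>i. i \<in> I \<Longrightarrow> f i \<subseteq> pts S"
  shows "sat S (\<Union>i\<in>I. sat S (f i)) = sat S (\<Union>i\<in>I. f i)"
proof (rule sat_eqI[OF assms(1)])
  show "(\<Union>i\<in>I. sat S (f i)) \<subseteq> sat S (\<Union>i\<in>I. f i)"
    by (intro UN_least sat_mono[OF assms(1)] UN_upper assms(2))
  have "(\<Union>i\<in>I. f i) \<subseteq> (\<Union>i\<in>I. sat S (f i))"
    by (intro UN_mono order_refl sat_self[OF assms(1)] assms(2))
  also have "\<dots> \<subseteq> sat S \<dots>"
    by (intro sat_self assms UN_least sat_pts)
  finally show "(\<Union>i\<in>I. f i) \<subseteq> sat S (\<Union>i\<in>I. sat S (f i))" .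
qed (auto simp: sat_def dest: assms(2)[THEN subsetD])

section \<open>Morphisms as inverse image maps\<close>

text \<open>
  The union of all representatives of a morphism is again a representative, its largest one.
  Taking it avoids a choice; by \<open>pre_eq_representative\<close> any other representative yields the same
  saturated set.
\<close>

definition pre :: "'a bcov \<Rightarrow> ('a \<times> 'b) set set \<Rightarrow> 'b set \<Rightarrow> 'a set" where
  "pre S R V = sat S ((\<Union>R)\<inverse> `` V)"

text \<open>
  The morphism with a prescribed inverse image on points, as the class of all maps that have it.
\<close>

definition mor :: "'a bcov \<Rightarrow> 'b bcov \<Rightarrow> ('b \<Rightarrow> 'a set) \<Rightarrow> ('a \<times> 'b) set set" where
  "mor S T f = {r \<in> bc_maps S T. \<forall>b\<in>pts T. sat S (r\<inverse> `` {b}) = sat S (f b)}"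

definition preserves_covers :: "'a bcov \<Rightarrow> 'b bcov \<Rightarrow> ('b \<Rightarrow> 'a set) \<Rightarrow> bool" where
  "preserves_covers S T f \<longleftrightarrow> (\<forall>b\<in>pts T. f b \<subseteq> pts S) \<and>
     (\<forall>b V. cov T b V \<longrightarrow> f b \<subseteq> sat S (\<Union>(f ` V)))"

lemma preserves_coversD:
  assumes "preserves_covers S T f"
  shows "cov T b V \<Longrightarrow> f b \<subseteq> sat S (\<Union>(f ` V))"
    and "V \<subseteq> pts T \<Longrightarrow> \<Union>(f ` V) \<subseteq> pts S"
    and "b \<in> pts T \<Longrightarrow> f b \<subseteq> pts S"
  using assms unfolding preserves_covers_def by blast+

lemma converse_Image_UN: "r\<inverse> `` V = (\<Union>b\<in>V. r\<inverse> `` {b})"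
  by blast

lemma equiv_bc_eq: "equiv (bc_maps S T) (bc_eq S T)"
  by (rule equivI) (auto simp: bc_eq_def refl_on_def sym_def trans_def)

lemma bc_homE:
  assumes "R \<in> bc_hom S T"
  obtains r where "r \<in> bc_maps S T" "r \<in> R" "R = bc_eq S T `` {r}"
  using assms equiv_class_self[OF equiv_bc_eq] unfolding bc_hom_def by (auto elim!: quotientE)

lemma bc_hom_mem: "R \<in> bc_hom S T \<Longrightarrow> r \<in> R \<Longrightarrow> r \<in> bc_maps S T"
  by (erule bc_homE) (auto simp: bc_eq_def)

lemma bc_maps_sub: "r \<in> bc_maps S T \<Longrightarrow> r\<inverse> `` V \<subseteq> pts S"
  by (auto simp: bc_maps_def)

lemma bc_maps_cov: "r \<in> bc_maps S T \<Longrightarrow> cov T b V \<Longrightarrow> set_cov S (r\<inverse> `` {b}) (r\<inverse> `` V)"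
  by (simp add: bc_maps_def)

lemma mor_eq_class: "r \<in> mor S T f \<Longrightarrow> mor S T f = bc_eq S T `` {r}"
  by (auto simp: mor_def bc_eq_def)

lemma mor_cong: "(\<And>b. b \<in> pts T \<Longrightarrow> sat S (f b) = sat S (g b)) \<Longrightarrow> mor S T f = mor S T g"
  by (simp add: mor_def)

text \<open>
  The relation \<open>a \<in> f b\<close> is a representative.
\<close>

lemma mor_in_hom:
  assumes S: "basic_cover S" and T: "basic_cover T" and f: "preserves_covers S T f"
  shows "mor S T f \<in> bc_hom S T"
proof -
  let ?r = "{(a, b). b \<in> pts T \<and> a \<in> f b}"
  have im: "?r\<inverse> `` V = \<Union>(f ` V)" if "V \<subseteq> pts T" for V using that by blast
  have "?r \<in> bc_maps S T"
    unfolding bc_maps_def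
  proof (intro CollectI conjI allI impI)
    show "?r \<subseteq> pts S \<times> pts T" using f unfolding preserves_covers_def by blast
    fix b V assume bV: "cov T b V"
    then have "b \<in> pts T" "V \<subseteq> pts T" using cov_pts[OF T] by blast+
    then show "set_cov S (?r\<inverse> `` {b}) (?r\<inverse> `` V)"
      using preserves_coversD[OF f] bV im[of V] im[of "{b}"] by (simp add: set_cov_iff_sat[OF S])
  qed
  then have "?r \<in> mor S T f" using im by (simp add: mor_def)
  from mor_eq_class[OF this] show ?thesis
    unfolding bc_hom_def by (simp add: quotientI \<open>?r \<in> bc_maps S T\<close>)
qed

lemma pre_eq_representative:
  assumes S: "basic_cover S" and R: "R \<in> bc_hom S T" and r: "r \<in> R" and V: "V \<subseteq> pts T"
  shows "pre S R V = sat S (r\<inverse> `` V)"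
  unfolding pre_def
proof (rule sat_eqI[OF S])
  note m = bc_hom_mem[OF R]
  show sub: "r\<inverse> `` V \<subseteq> pts S" using bc_maps_sub[OF m[OF r]] .
  show sub': "(\<Union>R)\<inverse> `` V \<subseteq> pts S" using m bc_maps_sub by blast
  show "r\<inverse> `` V \<subseteq> sat S ((\<Union>R)\<inverse> `` V)"
    using sat_self[OF S sub'] r by blast
  show "(\<Union>R)\<inverse> `` V \<subseteq> sat S (r\<inverse> `` V)"
  proof
    fix a assume "a \<in> (\<Union>R)\<inverse> `` V"
    then obtain b r' where b: "r' \<in> R" "b \<in> V" "a \<in> r'\<inverse> `` {b}" by blast
    have "(r, r') \<in> bc_eq S T"
      using in_quotient_imp_in_rel[OF equiv_bc_eq] R r b(1) unfolding bc_hom_def by fast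
    then have "sat S (r'\<inverse> `` {b}) = sat S (r\<inverse> `` {b})"
      using b(2) V by (auto simp: bc_eq_def)
    moreover have "a \<in> sat S (r'\<inverse> `` {b})"
      using sat_self[OF S bc_maps_sub[OF m[OF b(1)]]] b(3) by blast
    moreover have "sat S (r\<inverse> `` {b}) \<subseteq> sat S (r\<inverse> `` V)"
      using b(2) sub by (intro sat_mono[OF S]) auto
    ultimately show "a \<in> sat S (r\<inverse> `` V)" by blast
  qed
qed

lemma bc_hom_eq_mor:
  assumes S: "basic_cover S" and R: "R \<in> bc_hom S T"
  shows "R = mor S T (\<lambda>b. pre S R {b})"
proof -
  obtain r where r: "r \<in> bc_maps S T" "r \<in> R" "R = bc_eq S T `` {r}"
    using R by (rule bc_homE)
  have "sat S (pre S R {b}) = sat S (r\<inverse> `` {b})" if "b \<in> pts T" for b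
    using pre_eq_representative[OF S R r(2)] that sat_sat[OF S bc_maps_sub[OF r(1)]] by simp
  then have "r \<in> mor S T (\<lambda>b. pre S R {b})" using r(1) by (simp add: mor_def)
  then show ?thesis using mor_eq_class r(3) by blast
qed

lemma bc_hom_eqI:
  assumes "basic_cover S" "R \<in> bc_hom S T" "R' \<in> bc_hom S T"
    and "\<And>b. b \<in> pts T \<Longrightarrow> pre S R {b} = pre S R' {b}"
  shows "R = R'"
  using bc_hom_eq_mor[OF assms(1,2)] bc_hom_eq_mor[OF assms(1,3)] assms(4)
    mor_cong[of T S "\<lambda>b. pre S R {b}" "\<lambda>b. pre S R' {b}"] by simp

lemma pre_pts: "pre S R V \<subseteq> pts S"
  unfolding pre_def by (rule sat_pts)

lemma sat_pre:
  assumes "basic_cover S" "R \<in> bc_hom S T" "V \<subseteq> pts T"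
  shows "sat S (pre S R V) = pre S R V"
proof -
  obtain r where "r \<in> bc_maps S T" "r \<in> R" using assms(2) by (rule bc_homE)
  then show ?thesis
    using pre_eq_representative[OF assms(1,2) _ assms(3)] sat_sat[OF assms(1) bc_maps_sub] by simp
qed

lemma pre_UN:
  assumes S: "basic_cover S" and R: "R \<in> bc_hom S T" and V: "V \<subseteq> pts T"
  shows "pre S R V = sat S (\<Union>b\<in>V. pre S R {b})"
proof -
  obtain r where r: "r \<in> bc_maps S T" "r \<in> R" using R by (rule bc_homE)
  have "sat S (\<Union>b\<in>V. pre S R {b}) = sat S (\<Union>b\<in>V. sat S (r\<inverse> `` {b}))"
    using pre_eq_representative[OF S R r(2)] V by (intro arg_cong[where f = "sat S"] SUP_cong) auto
  also have "\<dots> = sat S (\<Union>b\<in>V. r\<inverse> `` {b})"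
    by (rule sat_UN_sat[OF S bc_maps_sub[OF r(1)]])
  also have "\<dots> = pre S R V"
    using pre_eq_representative[OF S R r(2) V] by (simp flip: converse_Image_UN)
  finally show ?thesis by simp
qed

text \<open>
  Inverse images respect covering, hence depend on a set only up to saturation
  (\<open>pre_cong_sat\<close>, \<open>pre_sat\<close>). This is the rewriting step behind all computations with
  composites.
\<close>

lemma pre_subset_pre:
  assumes S: "basic_cover S" and T: "basic_cover T" and R: "R \<in> bc_hom S T"
    and W: "W \<subseteq> pts T" and VW: "V \<subseteq> sat T W"
  shows "pre S R V \<subseteq> pre S R W"
proof -
  obtain r where r: "r \<in> bc_maps S T" "r \<in> R" using R by (rule bc_homE)
  have V: "V \<subseteq> pts T" by (rule subset_trans[OF VW sat_pts])
  have "r\<inverse> `` {b} \<subseteq> sat S (r\<inverse> `` W)" if "b \<in> V" for b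
  proof -
    have "cov T b W" using that VW W by (auto simp: cov_iff_sat[OF T])
    then have "set_cov S (r\<inverse> `` {b}) (r\<inverse> `` W)" using r(1) by (simp add: bc_maps_def)
    then show ?thesis by (simp add: set_cov_iff_sat[OF S bc_maps_sub[OF r(1)]])
  qed
  then have "r\<inverse> `` V \<subseteq> sat S (r\<inverse> `` W)" by blast
  then show ?thesis
    unfolding pre_eq_representative[OF S R r(2) V] pre_eq_representative[OF S R r(2) W]
    by (rule sat_subset_sat[OF S bc_maps_sub[OF r(1)]])
qed

lemma pre_mono:
  assumes "basic_cover S" "basic_cover T" "R \<in> bc_hom S T" "V \<subseteq> W" "W \<subseteq> pts T"
  shows "pre S R V \<subseteq> pre S R W"
  using pre_subset_pre[OF assms(1-3,5)] sat_self[OF assms(2,5)] assms(4) by blast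

lemma pre_cong_sat:
  assumes "basic_cover S" "basic_cover T" "R \<in> bc_hom S T" "V \<subseteq> pts T" "W \<subseteq> pts T"
    and "sat T V = sat T W"
  shows "pre S R V = pre S R W"
proof
  show "pre S R V \<subseteq> pre S R W"
    using pre_subset_pre[OF assms(1-3,5)] sat_self[OF assms(2,4)] assms(6) by simp
  show "pre S R W \<subseteq> pre S R V"
    using pre_subset_pre[OF assms(1-4)] sat_self[OF assms(2,5)] assms(6) by simp
qed

lemma pre_sat:
  assumes "basic_cover S" "basic_cover T" "R \<in> bc_hom S T" "V \<subseteq> pts T"
  shows "pre S R (sat T V) = pre S R V"
  by (rule pre_cong_sat[OF assms(1-3) sat_pts assms(4) sat_sat[OF assms(2,4)]])

lemma pre_mor:
  assumes S: "basic_cover S" and T: "basic_cover T" and f: "preserves_covers S T f" and V: "V \<subseteq> pts T"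
  shows "pre S (mor S T f) V = sat S (\<Union>b\<in>V. f b)"
proof -
  note h = mor_in_hom[OF S T f]
  obtain r where r: "r \<in> mor S T f" using h by (rule bc_homE)
  have "pre S (mor S T f) {b} = sat S (f b)" if "b \<in> V" for b
    using pre_eq_representative[OF S h r, of "{b}"] r that V by (auto simp: mor_def)
  then have "pre S (mor S T f) V = sat S (\<Union>b\<in>V. sat S (f b))"
    using pre_UN[OF S h V] by simp
  also have "\<dots> = sat S (\<Union>b\<in>V. f b)"
    using preserves_coversD(3)[OF f] V by (intro sat_UN_sat[OF S]) blast
  finally show ?thesis .
qed

lemma preserves_covers_pre:
  assumes "basic_cover S" "basic_cover T" "R \<in> bc_hom S T"
  shows "preserves_covers S T (\<lambda>b. pre S R {b})"
  unfolding preserves_covers_def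
proof (intro conjI ballI allI impI pre_pts)
  fix b V assume "cov T b V"
  then have "b \<in> sat T V" "V \<subseteq> pts T" by (simp_all add: cov_iff_sat[OF assms(2)])
  then show "pre S R {b} \<subseteq> sat S (\<Union>b\<in>V. pre S R {b})"
    using pre_subset_pre[OF assms] pre_UN[OF assms(1,3)] by simp
qed


lemma bc_id_hom:
  assumes S: "basic_cover S"
  shows "bc_id S \<in> bc_hom S S" and "V \<subseteq> pts S \<Longrightarrow> pre S (bc_id S) V = sat S V"
proof -
  have im: "(Id_on (pts S))\<inverse> `` V = V" if "V \<subseteq> pts S" for V using that by blast
  have "set_cov S ((Id_on (pts S))\<inverse> `` {b}) ((Id_on (pts S))\<inverse> `` V)" if "cov S b V" for b V
    using cov_pts[OF S that] that by (simp add: im set_cov_def Int_absorb1)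
  then have "Id_on (pts S) \<in> bc_maps S S" by (auto simp: bc_maps_def)
  then have "Id_on (pts S) \<in> bc_id S" "bc_id S \<in> bc_hom S S"
    using equiv_class_self[OF equiv_bc_eq] quotientI unfolding bc_id_def bc_hom_def by fast+
  then show "bc_id S \<in> bc_hom S S" and "V \<subseteq> pts S \<Longrightarrow> pre S (bc_id S) V = sat S V"
    by (simp_all add: pre_eq_representative[OF S] im del: Image_Id_on converse_Id_on)
qed

lemma relcomp_bc_maps:
  assumes r: "r \<in> bc_maps S T" and q: "q \<in> bc_maps T U"
  shows "r O q \<in> bc_maps S U"
proof -
  have "set_cov S ((r O q)\<inverse> `` {c}) ((r O q)\<inverse> `` W)" if "cov U c W" for c W
  proof -
    have "cov T b (q\<inverse> `` W)" if "b \<in> q\<inverse> `` {c}" for b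
      using bc_maps_cov[OF q \<open>cov U c W\<close>] that by (simp add: set_cov_def)
    then have "set_cov S (r\<inverse> `` {b}) (r\<inverse> `` (q\<inverse> `` W))" if "b \<in> q\<inverse> `` {c}" for b
      using bc_maps_cov[OF r] that by blast
    then show ?thesis
      using bc_maps_sub[OF r] by (auto simp: set_cov_def converse_relcomp relcomp_Image)
  qed
  moreover have "r O q \<subseteq> pts S \<times> pts U" using r q by (auto simp: bc_maps_def)
  ultimately show ?thesis by (simp add: bc_maps_def)
qed

text \<open>
  Any two representatives give composites with the same saturated inverse images, so the composite
  class is well defined.
\<close>

lemma bc_comp_hom:
  assumes S: "basic_cover S" and T: "basic_cover T"
    and R: "R \<in> bc_hom S T" and Q: "Q \<in> bc_hom T U"
  shows "bc_comp S T U Q R \<in> bc_hom S U"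
    and "V \<subseteq> pts U \<Longrightarrow> pre S (bc_comp S T U Q R) V = pre S R (pre T Q V)"
proof -
  have sat_rq: "sat S ((r O q)\<inverse> `` V) = pre S R (pre T Q V)"
    if "r \<in> R" "q \<in> Q" "V \<subseteq> pts U" for r q V
  proof -
    have sub: "q\<inverse> `` V \<subseteq> pts T" using bc_maps_sub bc_hom_mem[OF Q \<open>q \<in> Q\<close>] by blast
    have "pre S R (pre T Q V) = pre S R (q\<inverse> `` V)"
      using pre_eq_representative[OF T Q \<open>q \<in> Q\<close> \<open>V \<subseteq> pts U\<close>] pre_sat[OF S T R sub] by simp
    also have "\<dots> = sat S (r\<inverse> `` (q\<inverse> `` V))"
      by (rule pre_eq_representative[OF S R \<open>r \<in> R\<close> sub])
    finally show ?thesis by (simp add: converse_relcomp relcomp_Image)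
  qed
  obtain r where r: "r \<in> R" using R by (rule bc_homE)
  obtain q where q: "q \<in> Q" using Q by (rule bc_homE)
  have maps: "r' O q' \<in> bc_maps S U" if "r' \<in> R" "q' \<in> Q" for r' q'
    using relcomp_bc_maps[OF bc_hom_mem[OF R] bc_hom_mem[OF Q]] that by blast
  have "(r O q, r' O q') \<in> bc_eq S U" if "r' \<in> R" "q' \<in> Q" for r' q'
    using that r q by (auto simp: bc_eq_def maps sat_rq)
  then have "bc_comp S T U Q R = bc_eq S U `` {r O q}"
    using r q equiv_class_eq[OF equiv_bc_eq] unfolding bc_comp_def by fast
  then have mem: "r O q \<in> bc_comp S T U Q R"
    and hom: "bc_comp S T U Q R \<in> bc_hom S U"
    using equiv_class_self[OF equiv_bc_eq maps[OF r q]] quotientI[OF maps[OF r q]]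
    by (simp_all add: bc_hom_def)
  show "bc_comp S T U Q R \<in> bc_hom S U" by (rule hom)
  show "pre S (bc_comp S T U Q R) V = pre S R (pre T Q V)" if "V \<subseteq> pts U"
    using pre_eq_representative[OF S hom mem that] sat_rq[OF r q that] by simp
qed

lemma bc_hom_eq_iff:
  assumes "basic_cover S" "R \<in> bc_hom S T" "R' \<in> bc_hom S T"
  shows "R = R' \<longleftrightarrow> (\<forall>b\<in>pts T. pre S R {b} = pre S R' {b})"
  using bc_hom_eqI[OF assms] by auto

lemma bc_comp_id:
  assumes "basic_cover S" "basic_cover T" "R \<in> bc_hom S T"
  shows "bc_comp S S T R (bc_id S) = R" and "bc_comp S T T (bc_id T) R = R"
proof -
  note id = bc_id_hom[OF assms(1)] bc_id_hom[OF assms(2)]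
  show "bc_comp S S T R (bc_id S) = R"
    by (rule bc_hom_eqI[OF assms(1) bc_comp_hom(1)[OF assms(1,1) id(1) assms(3)] assms(3)])
      (simp add: bc_comp_hom(2)[OF assms(1,1) id(1) assms(3)] id pre_pts sat_pre[OF assms(1,3)])
  show "bc_comp S T T (bc_id T) R = R"
    by (rule bc_hom_eqI[OF assms(1) bc_comp_hom(1)[OF assms(1,2,3) id(3)] assms(3)])
      (simp add: bc_comp_hom(2)[OF assms(1,2,3) id(3)] id pre_sat[OF assms])
qed

lemma bc_comp_assoc:
  assumes S: "basic_cover S" and T: "basic_cover T" and U: "basic_cover U"
    and f: "f \<in> bc_hom S T" and g: "g \<in> bc_hom T U" and h: "h \<in> bc_hom U V"
  shows "bc_comp S U V h (bc_comp S T U g f) = bc_comp S T V (bc_comp T U V h g) f"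
proof (rule bc_hom_eqI[OF S])
  note gf = bc_comp_hom[OF S T f g] and hg = bc_comp_hom[OF T U g h]
  show "bc_comp S U V h (bc_comp S T U g f) \<in> bc_hom S V" by (rule bc_comp_hom(1)[OF S U gf(1) h])
  show "bc_comp S T V (bc_comp T U V h g) f \<in> bc_hom S V" by (rule bc_comp_hom(1)[OF S T f hg(1)])
  fix b assume "b \<in> pts V"
  then show "pre S (bc_comp S U V h (bc_comp S T U g f)) {b} =
      pre S (bc_comp S T V (bc_comp T U V h g) f) {b}"
    by (simp add: bc_comp_hom(2)[OF S U gf(1) h] bc_comp_hom(2)[OF S T f hg(1)] gf hg pre_pts)
qed

section \<open>The tensor product\<close>

text \<open>
  All covers together form an axiom-set that generates nothing new, because a basic cover is
  reflexive and transitive. Thus every basic cover is inductively generated, and its tensor products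
  can be computed from this canonical axiom-set.
\<close>

lemma basic_cover_eq_gen_cover:
  assumes S: "basic_cover S"
  shows "S = gen_cover (pts S) (\<lambda>a. {U. cov S a U}) (\<lambda>a U. U)"
    and "axiom_set (pts S) (\<lambda>a. {U. cov S a U}) (\<lambda>a U. U)"
proof -
  have "gen_cov (pts S) (\<lambda>a. {U. cov S a U}) (\<lambda>a U. U) a U \<longleftrightarrow> cov S a U" for a U
  proof
    assume U: "cov S a U"
    show "gen_cov (pts S) (\<lambda>a. {U. cov S a U}) (\<lambda>a U. U) a U"
      by (rule gen_cov.infinity[where i = U])
        (use U cov_pts[OF S U] in \<open>simp_all add: gen_cov.refl\<close>)
  next
    assume "gen_cov (pts S) (\<lambda>a. {U. cov S a U}) (\<lambda>a U. U) a U"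
    from gen_cov_least[OF S HOL.refl _ this] show "cov S a U" using cov_pts[OF S] by simp
  qed
  then show "S = gen_cover (pts S) (\<lambda>a. {U. cov S a U}) (\<lambda>a U. U)"
    by (intro bcov.equality) (simp_all add: gen_cover_def fun_eq_iff)
  show "axiom_set (pts S) (\<lambda>a. {U. cov S a U}) (\<lambda>a U. U)"
    using cov_pts[OF S] by (auto simp: axiom_set_def)
qed

lemma inductively_generated_iff: "inductively_generated S \<longleftrightarrow> basic_cover S"
proof
  assume "inductively_generated S"
  then show "basic_cover S" unfolding inductively_generated_def
    by (elim exE conjE) (erule ssubst, rule basic_cover_gen_cover)
next
  assume "basic_cover S"
  from basic_cover_eq_gen_cover[OF this] show "inductively_generated S"
    unfolding inductively_generated_def by (intro exI conjI)
qed

lemma tensor_eq_gen_tensor: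
  assumes "basic_cover S" "basic_cover T"
  shows "tensor S T = gen_tensor (pts S) (\<lambda>a. {U. cov S a U}) (\<lambda>a U. U)
    (pts T) (\<lambda>b. {V. cov T b V}) (\<lambda>b V. V)"
  using arg_cong2[OF basic_cover_eq_gen_cover(1)[OF assms(1)] basic_cover_eq_gen_cover(1)[OF assms(2)], of tensor]
    tensor_gen_cover[OF basic_cover_eq_gen_cover(2)[OF assms(1)] basic_cover_eq_gen_cover(2)[OF assms(2)]]
  by (rule trans)

lemma
  assumes S: "basic_cover S" and T: "basic_cover T"
  shows pts_tensor: "pts (tensor S T) = pairs (pts S) (pts T)"
    and basic_cover_tensor: "basic_cover (tensor S T)"
    and tensor_cov_left: "cov S a U \<Longrightarrow> b \<in> pts T \<Longrightarrow> cov (tensor S T) (Pr a b) (pairs U {b})"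
    and tensor_cov_right: "cov T b V \<Longrightarrow> a \<in> pts S \<Longrightarrow> cov (tensor S T) (Pr a b) (pairs {a} V)"
proof -
  note S' = basic_cover_eq_gen_cover[OF S] and T' = basic_cover_eq_gen_cover[OF T]
  have covS: "gen_cov (pts S) (\<lambda>a. {U. cov S a U}) (\<lambda>a U. U) = cov S"
    using arg_cong[OF S'(1), of cov] by (simp add: gen_cover_def)
  have covT: "gen_cov (pts T) (\<lambda>b. {V. cov T b V}) (\<lambda>b V. V) = cov T"
    using arg_cong[OF T'(1), of cov] by (simp add: gen_cover_def)
  note eq = tensor_eq_gen_tensor[OF S T]
  show "pts (tensor S T) = pairs (pts S) (pts T)"
    by (simp add: eq gen_tensor_def gen_cover_def)
  show "basic_cover (tensor S T)"
    by (simp add: eq gen_tensor_def basic_cover_gen_cover)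
  show "cov S a U \<Longrightarrow> b \<in> pts T \<Longrightarrow> cov (tensor S T) (Pr a b) (pairs U {b})"
    using gen_tensor_left[OF S'(2)] by (simp add: eq gen_tensor_def gen_cover_def covS)
  show "cov T b V \<Longrightarrow> a \<in> pts S \<Longrightarrow> cov (tensor S T) (Pr a b) (pairs {a} V)"
    using gen_tensor_right[OF T'(2)] by (simp add: eq gen_tensor_def gen_cover_def covT)
qed

lemma Pr_in_pairs [simp]: "Pr a b \<in> pairs U V \<longleftrightarrow> a \<in> U \<and> b \<in> V"
  by (simp add: pairs_def)

lemma ball_pairs: "(\<forall>x\<in>pairs U V. P x) \<longleftrightarrow> (\<forall>a\<in>U. \<forall>b\<in>V. P (Pr a b))"
  by (auto simp: pairs_def)

lemma UN_pairs: "(\<Union>x\<in>pairs U V. f x) = (\<Union>a\<in>U. \<Union>b\<in>V. f (Pr a b))"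
  by (auto simp: pairs_def)

lemma pairs_singletons [simp]: "pairs {a} {b} = {Pr a b}"
  by (auto simp: pairs_def)

lemma pairs_mono: "U \<subseteq> U' \<Longrightarrow> V \<subseteq> V' \<Longrightarrow> pairs U V \<subseteq> pairs U' V'"
  by (auto simp: pairs_def)

lemma pairs_UN_left: "pairs (\<Union>i\<in>I. f i) V = (\<Union>i\<in>I. pairs (f i) V)"
  by (auto simp: pairs_def)

lemma pairs_UN_right: "pairs U (\<Union>i\<in>I. f i) = (\<Union>i\<in>I. pairs U (f i))"
  by (auto simp: pairs_def)

lemma pairs_UN: "pairs (\<Union>i\<in>I. f i) (\<Union>j\<in>J. g j) = (\<Union>i\<in>I. \<Union>j\<in>J. pairs (f i) (g j))"
  by (auto simp: pairs_def)

text \<open>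
  The universal property of the tensor product. The relation ``\<open>f x\<close> is covered by the union of the
  \<open>f w\<close>, \<open>w \<in> W\<close>'' is itself a basic cover on \<open>S \<times> T\<close>. By separate preservation it satisfies the
  generating axioms, so it contains the least cover that does.
\<close>

lemma preserves_covers_tensorI:
  assumes X: "basic_cover X" and S: "basic_cover S" and T: "basic_cover T"
    and left: "\<And>b. b \<in> pts T \<Longrightarrow> preserves_covers X S (\<lambda>a. f (Pr a b))"
    and right: "\<And>a. a \<in> pts S \<Longrightarrow> preserves_covers X T (\<lambda>b. f (Pr a b))"
  shows "preserves_covers X (tensor S T) f"
proof -
  let ?P = "pairs (pts S) (pts T)"
  define B where "B = \<lparr>pts = ?P, cov = (\<lambda>x W. x \<in> ?P \<and> W \<subseteq> ?P \<and> f x \<subseteq> sat X (\<Union>(f ` W)))\<rparr>"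
  have "\<forall>x\<in>?P. f x \<subseteq> pts X"
    unfolding ball_pairs using preserves_coversD(3)[OF left] by simp
  then have f: "\<Union>(f ` W) \<subseteq> pts X" if "W \<subseteq> ?P" for W using that by (intro UN_least) (rule bspec, auto)
  have B: "basic_cover B"
    unfolding basic_cover_def
  proof (intro conjI allI impI)
    fix x W assume "cov B x W"
    then show "x \<in> pts B" "W \<subseteq> pts B" by (auto simp: B_def)
  next
    fix x W assume W: "W \<subseteq> pts B \<and> x \<in> W"
    then have "f x \<subseteq> \<Union>(f ` W)" by (intro UN_upper) simp
    also have "\<dots> \<subseteq> sat X \<dots>" using W by (intro sat_self[OF X] f) (simp add: B_def)
    finally show "cov B x W" using W by (auto simp: B_def)
  next
    fix x V W assume *: "cov B x V \<and> set_cov B V W"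
    then have W: "W \<subseteq> ?P" and V: "\<Union>(f ` V) \<subseteq> sat X (\<Union>(f ` W))"
      by (simp_all add: B_def set_cov_def UN_least)
    from * have "f x \<subseteq> sat X (\<Union>(f ` V))" by (simp add: B_def)
    also have "\<dots> \<subseteq> sat X (\<Union>(f ` W))" by (rule sat_subset_sat[OF X f[OF W] V])
    finally show "cov B x W" using * W by (simp add: B_def)
  qed
  have "cov B x W" if "cov (tensor S T) x W" for x W
  proof (rule gen_cov_least[OF B])
    show "pts B = ?P" by (simp add: B_def)
    show "gen_cov ?P (tensor_I (\<lambda>a. {U. cov S a U}) (\<lambda>b. {V. cov T b V}))
        (tensor_C (\<lambda>a U. U) (\<lambda>b V. V)) x W"
      using that by (simp add: tensor_eq_gen_tensor[OF S T] gen_tensor_def gen_cover_def)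
    fix y k
    assume y: "y \<in> ?P" and k: "k \<in> tensor_I (\<lambda>a. {U. cov S a U}) (\<lambda>b. {V. cov T b V}) y"
    from y obtain a b where ab: "y = Pr a b" "a \<in> pts S" "b \<in> pts T" by (auto simp: pairs_def)
    from k ab(1) consider (l) U where "k = Inl U" "cov S a U" | (r) V where "k = Inr V" "cov T b V"
      by auto
    then show "tensor_C (\<lambda>a U. U) (\<lambda>b V. V) y k \<subseteq> ?P \<and> cov B y (tensor_C (\<lambda>a U. U) (\<lambda>b V. V) y k)"
    proof cases
      case l
      then have "pairs U {b} \<subseteq> ?P" using cov_pts[OF S] ab by (simp add: pairs_mono)
      then show ?thesis
        using l ab preserves_coversD(1)[OF left l(2)] by (simp add: B_def UN_pairs)
    next
      case r
      then have "pairs {a} V \<subseteq> ?P" using cov_pts[OF T] ab by (simp add: pairs_mono)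
      then show ?thesis
        using r ab preserves_coversD(1)[OF right r(2)] by (simp add: B_def UN_pairs)
    qed
  qed
  then show ?thesis
    using f by (fastforce simp: preserves_covers_def B_def pts_tensor[OF S T])
qed

text \<open>
  Cover the two coordinates one after the other: \<open>(a, b) \<lhd> U \<times> {b} \<lhd> U \<times> V\<close>.
\<close>

lemma sat_pairs_sat:
  assumes S: "basic_cover S" and T: "basic_cover T" and U: "U \<subseteq> pts S" and V: "V \<subseteq> pts T"
  shows "sat (tensor S T) (pairs (sat S U) (sat T V)) = sat (tensor S T) (pairs U V)"
proof -
  let ?T = "tensor S T"
  note ten = basic_cover_tensor[OF S T]
  have UV: "pairs U V \<subseteq> pts ?T" using pairs_mono[OF U V] by (simp add: pts_tensor[OF S T])
  have sub: "pairs (sat S U) (sat T V) \<subseteq> pts ?T"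
    using pairs_mono[OF sat_pts sat_pts] by (simp add: pts_tensor[OF S T])
  have *: "Pr a b \<in> sat ?T (pairs U V)" if a: "a \<in> sat S U" and b: "b \<in> sat T V" for a b
  proof -
    have b': "b \<in> pts T" "cov T b V" using b by (simp_all add: sat_def)
    have "\<forall>y\<in>pairs U {b}. y \<in> sat ?T (pairs U V)"
      unfolding ball_pairs
    proof (intro ballI)
      fix u b' assume u: "u \<in> U" and "b' \<in> {b}"
      then have "cov ?T (Pr u b') (pairs {u} V)"
        using tensor_cov_right[OF S T b'(2)] U by auto
      then have "Pr u b' \<in> sat ?T (pairs {u} V)" using cov_iff_sat[OF ten] by simp
      then show "Pr u b' \<in> sat ?T (pairs U V)"
        using sat_mono[OF ten pairs_mono[of "{u}" U V V] UV] u by auto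
    qed
    then have 1: "pairs U {b} \<subseteq> sat ?T (pairs U V)" by blast
    have "cov ?T (Pr a b) (pairs U {b})"
      using tensor_cov_left[OF S T _ b'(1)] a by (simp add: sat_def)
    then have "Pr a b \<in> sat ?T (pairs U {b})" using cov_iff_sat[OF ten] by simp
    then show ?thesis using sat_subset_sat[OF ten UV 1] by (rule rev_subsetD)
  qed
  show ?thesis
  proof (rule sat_eqI[OF ten _ _ sub UV])
    show "pairs (sat S U) (sat T V) \<subseteq> sat ?T (pairs U V)" using * by (auto simp: pairs_def)
    have "pairs U V \<subseteq> pairs (sat S U) (sat T V)" by (intro pairs_mono sat_self S T U V)
    then show "pairs U V \<subseteq> sat ?T (pairs (sat S U) (sat T V))"
      using sat_self[OF ten sub] by (rule subset_trans)
  qed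
qed

lemma pairs_sat_subset:
  assumes S: "basic_cover S" and T: "basic_cover T" and U: "U \<subseteq> pts S" and V: "V \<subseteq> pts T"
  shows "pairs (sat S U) (sat T V) \<subseteq> sat (tensor S T) (pairs U V)"
  using sat_self[OF basic_cover_tensor[OF S T], of "pairs (sat S U) (sat T V)"]
    pairs_mono[OF sat_pts sat_pts, of S U T V]
  by (simp add: sat_pairs_sat[OF assms] pts_tensor[OF S T])

lemma preserves_covers_singleton:
  assumes "basic_cover S" shows "preserves_covers S S (\<lambda>a. {a})"
  using cov_iff_sat[OF assms] by (auto simp: preserves_covers_def)

lemma preserves_covers_pairs_left:
  assumes X: "basic_cover X" and S: "basic_cover S" and T: "basic_cover T"
    and f: "preserves_covers S X f" and B: "B \<subseteq> pts T"
  shows "preserves_covers (tensor S T) X (\<lambda>x. pairs (f x) B)"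
  unfolding preserves_covers_def
proof (intro conjI ballI allI impI)
  fix x assume "x \<in> pts X"
  then show "pairs (f x) B \<subseteq> pts (tensor S T)"
    using pairs_mono[OF preserves_coversD(3)[OF f] B] by (simp add: pts_tensor[OF S T])
next
  fix x V assume xV: "cov X x V"
  have "f x \<subseteq> sat S (\<Union>(f ` V))" by (rule preserves_coversD(1)[OF f xV])
  moreover have sub: "\<Union>(f ` V) \<subseteq> pts S"
    using preserves_coversD(2)[OF f] cov_pts[OF X xV] by blast
  ultimately show "pairs (f x) B \<subseteq> sat (tensor S T) (\<Union>x\<in>V. pairs (f x) B)"
    using subset_trans[OF pairs_mono[OF _ sat_self[OF T B]] pairs_sat_subset[OF S T sub B]]
    by (simp add: pairs_UN_left)
qed

lemma preserves_covers_pairs_right: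
  assumes X: "basic_cover X" and S: "basic_cover S" and T: "basic_cover T"
    and f: "preserves_covers T X f" and B: "B \<subseteq> pts S"
  shows "preserves_covers (tensor S T) X (\<lambda>x. pairs B (f x))"
  unfolding preserves_covers_def
proof (intro conjI ballI allI impI)
  fix x assume "x \<in> pts X"
  then show "pairs B (f x) \<subseteq> pts (tensor S T)"
    using pairs_mono[OF B preserves_coversD(3)[OF f]] by (simp add: pts_tensor[OF S T])
next
  fix x V assume xV: "cov X x V"
  have "f x \<subseteq> sat T (\<Union>(f ` V))" by (rule preserves_coversD(1)[OF f xV])
  moreover have sub: "\<Union>(f ` V) \<subseteq> pts T"
    using preserves_coversD(2)[OF f] cov_pts[OF X xV] by blast
  ultimately show "pairs B (f x) \<subseteq> sat (tensor S T) (\<Union>x\<in>V. pairs B (f x))"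
    using subset_trans[OF pairs_mono[OF sat_self[OF S B]] pairs_sat_subset[OF S T B sub]]
    by (simp add: pairs_UN_right)
qed

text \<open>
  The empty default only concerns points that lie outside every tensor product.
\<close>

definition on_pairs :: "('a elem \<Rightarrow> 'a elem \<Rightarrow> 'b set) \<Rightarrow> 'a elem \<Rightarrow> 'b set" where
  "on_pairs g x = (case x of Pr a b \<Rightarrow> g a b | _ \<Rightarrow> {})"

lemma on_pairs_Pr [simp]: "on_pairs g (Pr a b) = g a b"
  by (simp add: on_pairs_def)

lemma pairs_pre_subset: "pairs (pre S R U) (pre T Q V) \<subseteq> pairs (pts S) (pts T)"
  by (rule pairs_mono[OF pre_pts pre_pts])

context
  fixes S1 T1 S2 T2 :: "'a elem bcov" and R1 R2
  assumes S1: "basic_cover S1" and T1: "basic_cover T1" and R1: "R1 \<in> bc_hom S1 T1"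
    and S2: "basic_cover S2" and T2: "basic_cover T2" and R2: "R2 \<in> bc_hom S2 T2"
begin

text \<open>
  By \<open>sat_pairs_sat\<close>, replacing the representatives in \<open>r\<^sub>1\<^sup>- b\<^sub>1 \<times> r\<^sub>2\<^sup>- b\<^sub>2\<close> by the saturated inverse images
  does not change the saturation of the product.
\<close>

lemma tensor_mor_eq_mor:
  "tensor_mor S1 T1 S2 T2 R1 R2 =
    mor (tensor S1 S2) (tensor T1 T2) (on_pairs (\<lambda>b1 b2. pairs (pre S1 R1 {b1}) (pre S2 R2 {b2})))"
proof -
  let ?T = "tensor S1 S2"
  have *: "sat ?T (pairs (r1\<inverse> `` {b1}) (r2\<inverse> `` {b2})) = sat ?T (pairs (pre S1 R1 {b1}) (pre S2 R2 {b2}))"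
    if "r1 \<in> R1" "r2 \<in> R2" "b1 \<in> pts T1" "b2 \<in> pts T2" for r1 r2 b1 b2
  proof -
    note r = bc_hom_mem[OF R1 that(1)] bc_hom_mem[OF R2 that(2)]
    show ?thesis
      using pre_eq_representative[OF S1 R1 that(1), of "{b1}"] pre_eq_representative[OF S2 R2 that(2), of "{b2}"] that(3,4)
      by (simp add: sat_pairs_sat[OF S1 S2 bc_maps_sub[OF r(1)] bc_maps_sub[OF r(2)]])
  qed
  obtain r1 where r1: "r1 \<in> R1" using R1 by (rule bc_homE)
  obtain r2 where r2: "r2 \<in> R2" using R2 by (rule bc_homE)
  have "(\<exists>r1\<in>R1. \<exists>r2\<in>R2. \<forall>b1\<in>pts T1. \<forall>b2\<in>pts T2.
       sat ?T (r\<inverse> `` {Pr b1 b2}) = sat ?T (pairs (r1\<inverse> `` {b1}) (r2\<inverse> `` {b2}))) \<longleftrightarrow>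
     (\<exists>r1\<in>R1. \<exists>r2\<in>R2. \<forall>b1\<in>pts T1. \<forall>b2\<in>pts T2.
       sat ?T (r\<inverse> `` {Pr b1 b2}) = sat ?T (pairs (pre S1 R1 {b1}) (pre S2 R2 {b2})))" for r
    by (simp add: * cong: bex_cong ball_cong)
  also have "\<dots> r \<longleftrightarrow> (\<forall>b1\<in>pts T1. \<forall>b2\<in>pts T2.
       sat ?T (r\<inverse> `` {Pr b1 b2}) = sat ?T (pairs (pre S1 R1 {b1}) (pre S2 R2 {b2})))" for r
    using r1 r2 by auto
  finally show ?thesis
    by (simp add: tensor_mor_def mor_def pts_tensor T1 T2 ball_pairs)
qed

lemma preserves_covers_tensor_mor:
  "preserves_covers (tensor S1 S2) (tensor T1 T2)
    (on_pairs (\<lambda>b1 b2. pairs (pre S1 R1 {b1}) (pre S2 R2 {b2})))"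
  by (rule preserves_covers_tensorI[OF basic_cover_tensor[OF S1 S2] T1 T2])
    (simp_all add: preserves_covers_pairs_left preserves_covers_pairs_right preserves_covers_pre
      S1 S2 T1 T2 R1 R2 pre_pts)

lemma tensor_mor_hom: "tensor_mor S1 T1 S2 T2 R1 R2 \<in> bc_hom (tensor S1 S2) (tensor T1 T2)"
  unfolding tensor_mor_eq_mor
  by (intro mor_in_hom basic_cover_tensor S1 S2 T1 T2 preserves_covers_tensor_mor)

lemma pre_tensor_mor:
  assumes V: "V1 \<subseteq> pts T1" "V2 \<subseteq> pts T2"
  shows "pre (tensor S1 S2) (tensor_mor S1 T1 S2 T2 R1 R2) (pairs V1 V2) =
    sat (tensor S1 S2) (pairs (pre S1 R1 V1) (pre S2 R2 V2))"
proof -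
  have sub: "pairs V1 V2 \<subseteq> pts (tensor T1 T2)"
    using pairs_mono[OF V] by (simp add: pts_tensor[OF T1 T2])
  have "pre (tensor S1 S2) (tensor_mor S1 T1 S2 T2 R1 R2) (pairs V1 V2) =
      sat (tensor S1 S2) (pairs (\<Union>b\<in>V1. pre S1 R1 {b}) (\<Union>b\<in>V2. pre S2 R2 {b}))"
    unfolding tensor_mor_eq_mor
      pre_mor[OF basic_cover_tensor[OF S1 S2] basic_cover_tensor[OF T1 T2] preserves_covers_tensor_mor sub]
    by (simp only: UN_pairs pairs_UN on_pairs_Pr)
  also have "\<dots> = sat (tensor S1 S2) (pairs (sat S1 (\<Union>b\<in>V1. pre S1 R1 {b})) (sat S2 (\<Union>b\<in>V2. pre S2 R2 {b})))"
    by (intro sat_pairs_sat[OF S1 S2, symmetric] UN_least pre_pts)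
  finally show ?thesis
    by (simp flip: pre_UN[OF S1 R1 V(1)] pre_UN[OF S2 R2 V(2)])
qed

end

lemma
  fixes S1 S2 S3 :: "'a elem bcov"
  assumes S1: "basic_cover S1" and S2: "basic_cover S2" and S3: "basic_cover S3"
  shows assoc_mor_hom: "assoc_mor S1 S2 S3 \<in> bc_hom (tensor S1 (tensor S2 S3)) (tensor (tensor S1 S2) S3)"
    and pre_assoc_mor: "a \<in> pts S1 \<Longrightarrow> b \<in> pts S2 \<Longrightarrow> c \<in> pts S3 \<Longrightarrow>
      pre (tensor S1 (tensor S2 S3)) (assoc_mor S1 S2 S3) {Pr (Pr a b) c} =
      sat (tensor S1 (tensor S2 S3)) {Pr a (Pr b c)}"
proof -
  let ?L = "tensor (tensor S1 S2) S3" and ?R = "tensor S1 (tensor S2 S3)"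
  let ?f = "on_pairs (\<lambda>x c. on_pairs (\<lambda>a b. pairs {a} (pairs {b} {c})) x)"
  note ten = basic_cover_tensor[OF S1 S2] basic_cover_tensor[OF S2 S3]
    basic_cover_tensor[OF S1 basic_cover_tensor[OF S2 S3]]
    basic_cover_tensor[OF basic_cover_tensor[OF S1 S2] S3]
  note pts = pts_tensor[OF S1 S2] pts_tensor[OF S2 S3]
    pts_tensor[OF S1 ten(2)] pts_tensor[OF ten(1) S3]
  have eq: "assoc_mor S1 S2 S3 = mor ?R ?L ?f"
    by (simp add: assoc_mor_def mor_def pts ball_pairs)
  have f: "preserves_covers ?R ?L ?f"
  proof (rule preserves_covers_tensorI[OF ten(3,1) S3])
    fix c assume c: "c \<in> pts S3"
    show "preserves_covers ?R (tensor S1 S2) (\<lambda>x. ?f (Pr x c))"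
    proof (rule preserves_covers_tensorI[OF ten(3) S1 S2])
      fix b assume "b \<in> pts S2"
      then show "preserves_covers ?R S1 (\<lambda>a. ?f (Pr (Pr a b) c))"
        unfolding on_pairs_Pr using c
        by (intro preserves_covers_pairs_left[OF S1 S1 ten(2)] preserves_covers_singleton[OF S1]) (simp add: pts)
    next
      fix a assume "a \<in> pts S1"
      then show "preserves_covers ?R S2 (\<lambda>b. ?f (Pr (Pr a b) c))"
        unfolding on_pairs_Pr using c
        by (intro preserves_covers_pairs_right[OF S2 S1 ten(2)] preserves_covers_pairs_left[OF S2 S2 S3]
            preserves_covers_singleton[OF S2]) simp_all
    qed
  next
    fix x assume "x \<in> pts (tensor S1 S2)"
    then obtain a b where x: "x = Pr a b" "a \<in> pts S1" "b \<in> pts S2" by (auto simp: pts pairs_def)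
    show "preserves_covers ?R S3 (\<lambda>c. ?f (Pr x c))"
      unfolding on_pairs_Pr x(1) using x(2,3)
      by (intro preserves_covers_pairs_right[OF S3 S1 ten(2)] preserves_covers_pairs_right[OF S3 S2 S3]
            preserves_covers_singleton[OF S3]) simp_all
  qed
  show "assoc_mor S1 S2 S3 \<in> bc_hom ?R ?L"
    unfolding eq by (rule mor_in_hom[OF ten(3,4) f])
  show "a \<in> pts S1 \<Longrightarrow> b \<in> pts S2 \<Longrightarrow> c \<in> pts S3 \<Longrightarrow>
      pre ?R (assoc_mor S1 S2 S3) {Pr (Pr a b) c} = sat ?R {Pr a (Pr b c)}"
    unfolding eq by (subst pre_mor[OF ten(3,4) f]) (simp_all add: pts)
qed

lemma
  fixes S1 S2 :: "'a elem bcov"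
  assumes S1: "basic_cover S1" and S2: "basic_cover S2"
  shows sym_mor_hom: "sym_mor S1 S2 \<in> bc_hom (tensor S1 S2) (tensor S2 S1)"
    and pre_sym_mor: "a \<in> pts S1 \<Longrightarrow> b \<in> pts S2 \<Longrightarrow>
      pre (tensor S1 S2) (sym_mor S1 S2) {Pr b a} = sat (tensor S1 S2) {Pr a b}"
proof -
  let ?f = "on_pairs (\<lambda>b a. pairs {a} {b})"
  note ten = basic_cover_tensor[OF S1 S2] basic_cover_tensor[OF S2 S1]
  note pts = pts_tensor[OF S1 S2] pts_tensor[OF S2 S1]
  have eq: "sym_mor S1 S2 = mor (tensor S1 S2) (tensor S2 S1) ?f"
    by (auto simp: sym_mor_def mor_def pts ball_pairs)
  have f: "preserves_covers (tensor S1 S2) (tensor S2 S1) ?f"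
    by (rule preserves_covers_tensorI[OF ten(1) S2 S1])
      (simp_all only: on_pairs_Pr preserves_covers_pairs_left[OF S1 S1 S2 preserves_covers_singleton[OF S1]]
        preserves_covers_pairs_right[OF S2 S1 S2 preserves_covers_singleton[OF S2]] empty_subsetI insert_subset)
  show "sym_mor S1 S2 \<in> bc_hom (tensor S1 S2) (tensor S2 S1)"
    unfolding eq by (rule mor_in_hom[OF ten f])
  show "a \<in> pts S1 \<Longrightarrow> b \<in> pts S2 \<Longrightarrow>
      pre (tensor S1 S2) (sym_mor S1 S2) {Pr b a} = sat (tensor S1 S2) {Pr a b}"
    unfolding eq by (subst pre_mor[OF ten f]) (simp_all add: pts)
qed

section \<open>Commutative co-semigroups in terms of inverse images\<close>

text \<open>
  Both sides of co-associativity are morphisms into \<open>(X \<otimes> X) \<otimes> X\<close>, so they agree iff their inverse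
  images agree at every point \<open>((a, b), c)\<close>. There \<open>\<alpha> \<cdot> (id \<otimes> \<mu>) \<cdot> \<mu>\<close> gives \<open>\<mu>\<^sup>- (a, \<mu>\<^sup>- (b, c))\<close> and
  \<open>(\<mu> \<otimes> id) \<cdot> \<mu>\<close> gives \<open>\<mu>\<^sup>- (\<mu>\<^sup>- (a, b), c)\<close>.
\<close>

lemma comm_cosemigroup_iff:
  "comm_cosemigroup BCov_i X \<mu> \<longleftrightarrow> basic_cover X \<and> \<mu> \<in> bc_hom X (tensor X X) \<and>
    (\<forall>a\<in>pts X. \<forall>b\<in>pts X. \<forall>c\<in>pts X.
      pre X \<mu> (pairs {a} (pre X \<mu> {Pr b c})) = pre X \<mu> (pairs (pre X \<mu> {Pr a b}) {c})) \<and>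
    (\<forall>a\<in>pts X. \<forall>b\<in>pts X. pre X \<mu> {Pr b a} = pre X \<mu> {Pr a b})"
proof (cases "basic_cover X \<and> \<mu> \<in> bc_hom X (tensor X X)")
  case False
  then show ?thesis by (auto simp: comm_cosemigroup_def BCov_i_def inductively_generated_iff Let_def)
next
  case True
  then have X: "basic_cover X" and mu: "\<mu> \<in> bc_hom X (tensor X X)" by blast+
  let ?X2 = "tensor X X"
  let ?L = "tensor ?X2 X" and ?R = "tensor X ?X2"
  have X2: "basic_cover ?X2" and L: "basic_cover ?L" and R: "basic_cover ?R"
    by (intro basic_cover_tensor X)+
  note pts = pts_tensor[OF X X] pts_tensor[OF X X2] pts_tensor[OF X2 X]
  note id = bc_id_hom[OF X] and alpha = assoc_mor_hom[OF X X X] and gamma = sym_mor_hom[OF X X]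
  have idmu: "tensor_mor X X X ?X2 (bc_id X) \<mu> \<in> bc_hom ?X2 ?R"
    by (rule tensor_mor_hom[OF X X id(1) X X2 mu])
  have muid: "tensor_mor X ?X2 X X \<mu> (bc_id X) \<in> bc_hom ?X2 ?L"
    by (rule tensor_mor_hom[OF X X2 mu X X id(1)])
  note c1 = bc_comp_hom[OF X X2 mu idmu]
  note c2 = bc_comp_hom[OF X R c1(1) alpha]
  note c3 = bc_comp_hom[OF X X2 mu muid]
  note c4 = bc_comp_hom[OF X X2 mu gamma]
  have pre_pairs: "pre X \<mu> (sat ?X2 (pairs (sat X U) (sat X V))) = pre X \<mu> (pairs U V)"
    if "U \<subseteq> pts X" "V \<subseteq> pts X" for U V
    using pre_sat[OF X X2 mu] pairs_mono[OF that] by (simp add: sat_pairs_sat[OF X X that] pts)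
  let ?left = "bc_comp X ?R ?L (assoc_mor X X X)
    (bc_comp X ?X2 ?R (tensor_mor X X X ?X2 (bc_id X) \<mu>) \<mu>)"
  have left: "pre X ?left {Pr (Pr a b) c} =
      pre X \<mu> (pairs {a} (pre X \<mu> {Pr b c}))"
    if abc: "a \<in> pts X" "b \<in> pts X" "c \<in> pts X" for a b c
  proof -
    have "pre X ?left {Pr (Pr a b) c} =
        pre X (bc_comp X ?X2 ?R (tensor_mor X X X ?X2 (bc_id X) \<mu>) \<mu>) (pairs {a} {Pr b c})"
      using abc by (simp add: c2(2) pts pre_assoc_mor[OF X X X] pre_sat[OF X R c1(1)])
    also have "\<dots> = pre X \<mu> (sat ?X2 (pairs (sat X {a}) (sat X (pre X \<mu> {Pr b c}))))"
      using abc pre_tensor_mor[OF X X id(1) X X2 mu, of "{a}" "{Pr b c}"]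
      by (simp add: c1(2) pts id sat_pre[OF X mu])
    also have "\<dots> = pre X \<mu> (pairs {a} (pre X \<mu> {Pr b c}))"
      using abc by (intro pre_pairs pre_pts) simp
    finally show ?thesis .
  qed
  let ?right = "bc_comp X ?X2 ?L (tensor_mor X ?X2 X X \<mu> (bc_id X)) \<mu>"
  have right: "pre X ?right {Pr (Pr a b) c} =
      pre X \<mu> (pairs (pre X \<mu> {Pr a b}) {c})"
    if abc: "a \<in> pts X" "b \<in> pts X" "c \<in> pts X" for a b c
  proof -
    have "pre X ?right {Pr (Pr a b) c} =
        pre X \<mu> (sat ?X2 (pairs (sat X (pre X \<mu> {Pr a b})) (sat X {c})))"
      using abc pre_tensor_mor[OF X X2 mu X X id(1), of "{Pr a b}" "{c}"]
      by (simp add: c3(2) pts id sat_pre[OF X mu])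
    also have "\<dots> = pre X \<mu> (pairs (pre X \<mu> {Pr a b}) {c})"
      using abc by (intro pre_pairs pre_pts) simp
    finally show ?thesis .
  qed
  have sym: "pre X (bc_comp X ?X2 ?X2 (sym_mor X X) \<mu>) {Pr b a} = pre X \<mu> {Pr a b}"
    if "a \<in> pts X" "b \<in> pts X" for a b
    using that by (simp add: c4(2) pts pre_sym_mor[OF X X] pre_sat[OF X X2 mu])
  show ?thesis
    unfolding comm_cosemigroup_def Let_def
    by (simp add: BCov_i_def inductively_generated_iff X mu pts ball_pairs left right sym
        bc_hom_eq_iff[OF X c2(1) c3(1)] bc_hom_eq_iff[OF X c4(1) mu])
qed

context
  fixes X Y :: "'a elem bcov" and \<mu> \<nu>
  assumes X: "basic_cover X" and \<mu>: "\<mu> \<in> bc_hom X (tensor X X)"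
    and Y: "basic_cover Y" and \<nu>: "\<nu> \<in> bc_hom Y (tensor Y Y)"
begin

text \<open>
  Evaluating on arbitrary products, rather than only at points, is what later extends the condition
  on convergent cover maps from points to subsets (\<open>pre_cop\<close>).
\<close>

lemma pre_comult_tensor_mor:
  assumes f: "f \<in> bc_hom X Y" and V: "V1 \<subseteq> pts Y" "V2 \<subseteq> pts Y"
  shows "pre X (bc_comp X Y (tensor Y Y) \<nu> f) (pairs V1 V2) = pre X f (pre Y \<nu> (pairs V1 V2))"
    and "pre X (bc_comp X (tensor X X) (tensor Y Y) (tensor_mor X Y X Y f f) \<mu>) (pairs V1 V2) =
      pre X \<mu> (pairs (pre X f V1) (pre X f V2))"
proof -
  note XX = basic_cover_tensor[OF X X]
  have sub: "pairs V1 V2 \<subseteq> pts (tensor Y Y)" using pairs_mono[OF V] by (simp add: pts_tensor[OF Y Y])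
  show "pre X (bc_comp X Y (tensor Y Y) \<nu> f) (pairs V1 V2) = pre X f (pre Y \<nu> (pairs V1 V2))"
    by (rule bc_comp_hom(2)[OF X Y f \<nu> sub])
  show "pre X (bc_comp X (tensor X X) (tensor Y Y) (tensor_mor X Y X Y f f) \<mu>) (pairs V1 V2) =
      pre X \<mu> (pairs (pre X f V1) (pre X f V2))"
    using bc_comp_hom(2)[OF X XX \<mu> tensor_mor_hom[OF X Y f X Y f] sub]
      pre_sat[OF X XX \<mu>] pairs_pre_subset[of X f V1 X f V2]
    by (simp add: pre_tensor_mor[OF X Y f X Y f V] pts_tensor[OF X X])
qed

lemma cosemigroup_map_iff:
  "cosemigroup_map BCov_i X \<mu> Y \<nu> f \<longleftrightarrow> f \<in> bc_hom X Y \<and>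
    (\<forall>b1\<in>pts Y. \<forall>b2\<in>pts Y. pre X f (pre Y \<nu> {Pr b1 b2}) = pre X \<mu> (pairs (pre X f {b1}) (pre X f {b2})))"
proof (cases "f \<in> bc_hom X Y")
  case f: True
  show ?thesis
    using pre_comult_tensor_mor[OF f, of "{_}" "{_}"]
    by (simp add: cosemigroup_map_def BCov_i_def f pts_tensor[OF Y Y] ball_pairs
        bc_hom_eq_iff[OF X bc_comp_hom(1)[OF X Y f \<nu>]
          bc_comp_hom(1)[OF X basic_cover_tensor[OF X X] \<mu> tensor_mor_hom[OF X Y f X Y f]]])
qed (simp add: cosemigroup_map_def BCov_i_def)

lemma cosemigroup_mapD:
  assumes "cosemigroup_map BCov_i X \<mu> Y \<nu> f" and V: "V1 \<subseteq> pts Y" "V2 \<subseteq> pts Y"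
  shows "pre X f (pre Y \<nu> (pairs V1 V2)) = pre X \<mu> (pairs (pre X f V1) (pre X f V2))"
proof -
  from assms(1) have f: "f \<in> bc_hom X Y" and
    "bc_comp X Y (tensor Y Y) \<nu> f = bc_comp X (tensor X X) (tensor Y Y) (tensor_mor X Y X Y f f) \<mu>"
    by (simp_all add: cosemigroup_map_def BCov_i_def)
  then show ?thesis using pre_comult_tensor_mor[OF f V] by simp
qed

end

section \<open>Convergent covers\<close>

text \<open>
  The operation commutes with unions on the nose. A general convergent cover requires this only up
  to saturation.
\<close>

definition additive :: "'a ccov \<Rightarrow> bool" where
  "additive K \<longleftrightarrow> (\<forall>U V. U \<subseteq> cpts K \<longrightarrow> V \<subseteq> cpts K \<longrightarrow>
     cop K U V = delta_op (\<lambda>a b. cop K {a} {b}) U V)"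

lemma
  assumes "additive K"
  shows cop_UN_right: "U \<subseteq> cpts K \<Longrightarrow> (\<And>i. i \<in> I \<Longrightarrow> f i \<subseteq> cpts K) \<Longrightarrow>
      cop K U (\<Union>i\<in>I. f i) = (\<Union>i\<in>I. cop K U (f i))"
    and cop_UN_left: "U \<subseteq> cpts K \<Longrightarrow> (\<And>i. i \<in> I \<Longrightarrow> f i \<subseteq> cpts K) \<Longrightarrow>
      cop K (\<Union>i\<in>I. f i) U = (\<Union>i\<in>I. cop K (f i) U)"
proof -
  have op: "cop K U V = (\<Union>a\<in>U. \<Union>b\<in>V. cop K {a} {b})" if "U \<subseteq> cpts K" "V \<subseteq> cpts K" for U V
    using assms that by (simp add: additive_def delta_op_def)
  show "cop K U (\<Union>i\<in>I. f i) = (\<Union>i\<in>I. cop K U (f i))"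
    if "U \<subseteq> cpts K" "\<And>i. i \<in> I \<Longrightarrow> f i \<subseteq> cpts K"
  proof -
    have "(\<Union>i\<in>I. cop K U (f i)) = (\<Union>i\<in>I. \<Union>a\<in>U. \<Union>b\<in>f i. cop K {a} {b})"
      by (rule SUP_cong[OF HOL.refl op[OF that]])
    moreover have "cop K U (\<Union>i\<in>I. f i) = (\<Union>a\<in>U. \<Union>b\<in>\<Union>i\<in>I. f i. cop K {a} {b})"
      by (intro op UN_least that)
    ultimately show ?thesis by auto
  qed
  show "cop K (\<Union>i\<in>I. f i) U = (\<Union>i\<in>I. cop K (f i) U)"
    if "U \<subseteq> cpts K" "\<And>i. i \<in> I \<Longrightarrow> f i \<subseteq> cpts K"
  proof -
    have "(\<Union>i\<in>I. cop K (f i) U) = (\<Union>i\<in>I. \<Union>a\<in>f i. \<Union>b\<in>U. cop K {a} {b})"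
      by (rule SUP_cong[OF HOL.refl op[OF that(2,1)]])
    moreover have "cop K (\<Union>i\<in>I. f i) U = (\<Union>a\<in>\<Union>i\<in>I. f i. \<Union>b\<in>U. cop K {a} {b})"
      by (intro op UN_least that)
    ultimately show ?thesis by auto
  qed
qed

lemma
  assumes "convergent_cover K"
  shows convergent_cover_basic: "basic_cover (cover K)"
    and cop_pts: "cop K U V \<subseteq> cpts K"
    and cop_outside: "\<not> (U \<subseteq> cpts K \<and> V \<subseteq> cpts K) \<Longrightarrow> cop K U V = {}"
    and cop_set_cov: "set_cov (cover K) U1 V1 \<Longrightarrow> set_cov (cover K) U2 V2 \<Longrightarrow>
      set_cov (cover K) (cop K U1 U2) (cop K V1 V2)"
    and cop_assoc: "U \<subseteq> cpts K \<Longrightarrow> V \<subseteq> cpts K \<Longrightarrow> W \<subseteq> cpts K \<Longrightarrow>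
      set_cov (cover K) (cop K (cop K U V) W) (cop K U (cop K V W))"
    and cop_comm: "U \<subseteq> cpts K \<Longrightarrow> V \<subseteq> cpts K \<Longrightarrow> set_cov (cover K) (cop K U V) (cop K V U)"
  using assms unfolding convergent_cover_def by (elim conjE, simp)+

text \<open>
  Distributivity over joins need not be checked separately: an additive operation commutes with
  unions, and compatibility with covers allows saturating inside and outside.
\<close>

lemma convergent_coverI:
  assumes K: "basic_cover (cover K)" and add: "additive K"
    and pts: "\<And>U V. cop K U V \<subseteq> cpts K"
    and outside: "\<And>U V. \<not> (U \<subseteq> cpts K \<and> V \<subseteq> cpts K) \<Longrightarrow> cop K U V = {}"
    and cov: "\<And>U1 V1 U2 V2. set_cov (cover K) U1 V1 \<Longrightarrow> set_cov (cover K) U2 V2 \<Longrightarrow>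
      set_cov (cover K) (cop K U1 U2) (cop K V1 V2)"
    and assoc: "\<And>U V W. U \<subseteq> cpts K \<Longrightarrow> V \<subseteq> cpts K \<Longrightarrow> W \<subseteq> cpts K \<Longrightarrow>
      set_cov (cover K) (cop K (cop K U V) W) (cop K U (cop K V W))"
    and comm: "\<And>U V. U \<subseteq> cpts K \<Longrightarrow> V \<subseteq> cpts K \<Longrightarrow> set_cov (cover K) (cop K U V) (cop K V U)"
  shows "convergent_cover K"
proof -
  have distrib: "sat_op K X (sat_join (cover K) \<Y>) = sat_join (cover K) {sat_op K X Y | Y. Y \<in> \<Y>}"
      "sat_op K (sat_join (cover K) \<Y>) X = sat_join (cover K) {sat_op K Y X | Y. Y \<in> \<Y>}"
    if X: "X \<in> Sat (cover K)" and Y: "\<Y> \<subseteq> Sat (cover K)" for X \<Y>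
  proof -
    have X': "X \<subseteq> cpts K" using X by (simp add: Sat_def)
    have Y': "Y \<subseteq> cpts K" if "Y \<in> \<Y>" for Y using that Y by (auto simp: Sat_def)
    have J: "\<Union>\<Y> \<subseteq> cpts K" using Y' by blast
    have cX: "set_cov (cover K) X X"
      using set_cov_iff_sat[OF K X'] sat_self[OF K X'] by simp
    have c1: "set_cov (cover K) (\<Union>\<Y>) (sat (cover K) (\<Union>\<Y>))"
      using set_cov_iff_sat[OF K sat_pts, of "\<Union>\<Y>" "\<Union>\<Y>"] sat_sat[OF K J] sat_self[OF K J] by simp
    have c2: "set_cov (cover K) (sat (cover K) (\<Union>\<Y>)) (\<Union>\<Y>)"
      using set_cov_iff_sat[OF K J] by simp
    have "sat (cover K) (cop K X (sat (cover K) (\<Union>\<Y>))) = sat (cover K) (cop K X (\<Union>\<Y>))"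
      using cov[OF cX c1] cov[OF cX c2]
      by (intro sat_eqI[OF K _ _ pts pts]) (simp_all add: set_cov_iff_sat[OF K pts])
    also have "cop K X (\<Union>\<Y>) = (\<Union>Y\<in>\<Y>. cop K X Y)"
      using cop_UN_right[OF add X' Y', of \<Y> "\<lambda>Y. Y"] by simp
    also have "sat (cover K) \<dots> = sat (cover K) (\<Union>Y\<in>\<Y>. sat (cover K) (cop K X Y))"
      by (rule sat_UN_sat[OF K pts, symmetric])
    finally show "sat_op K X (sat_join (cover K) \<Y>) = sat_join (cover K) {sat_op K X Y | Y. Y \<in> \<Y>}"
      by (simp add: sat_op_def sat_join_def setcompr_eq_image)
    have "sat (cover K) (cop K (sat (cover K) (\<Union>\<Y>)) X) = sat (cover K) (cop K (\<Union>\<Y>) X)"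
      using cov[OF c1 cX] cov[OF c2 cX]
      by (intro sat_eqI[OF K _ _ pts pts]) (simp_all add: set_cov_iff_sat[OF K pts])
    also have "cop K (\<Union>\<Y>) X = (\<Union>Y\<in>\<Y>. cop K Y X)"
      using cop_UN_left[OF add X' Y', of \<Y> "\<lambda>Y. Y"] by simp
    also have "sat (cover K) \<dots> = sat (cover K) (\<Union>Y\<in>\<Y>. sat (cover K) (cop K Y X))"
      by (rule sat_UN_sat[OF K pts, symmetric])
    finally show "sat_op K (sat_join (cover K) \<Y>) X = sat_join (cover K) {sat_op K Y X | Y. Y \<in> \<Y>}"
      by (simp add: sat_op_def sat_join_def setcompr_eq_image)
  qed
  show ?thesis
    unfolding convergent_cover_def
    by (intro conjI allI impI ballI K pts outside distrib cov assoc comm; (elim conjE)?; assumption)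
qed

text \<open>
  If \<open>K\<close> is generated from \<open>\<delta>\<close>, then \<open>\<delta> a b = {a} \<circ> {b}\<close> and \<open>\<circ>\<close> is a union of these values.
  Conversely, take \<open>\<delta> a b = {a} \<circ> {b}\<close> and all covers of \<open>K\<close> as the axiom-set. The axioms added for
  commutativity, associativity and stability are instances of the laws of a convergent cover, so they
  generate no further covers.
\<close>

lemma inductively_generated_cc_iff_additive:
  assumes K: "convergent_cover K"
  shows "inductively_generated_cc K \<longleftrightarrow> additive K"
proof
  assume "inductively_generated_cc K"
  then obtain I :: "'a \<Rightarrow> 'a set set" and C \<delta> where "K = gen_conv_cover (cpts K) I C \<delta>"
    unfolding inductively_generated_cc_def by blast
  from arg_cong[OF this, of cop]
  have op: "cop K U V = (if U \<subseteq> cpts K \<and> V \<subseteq> cpts K then delta_op \<delta> U V else {})" for U V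
    by (simp add: gen_conv_cover_def)
  show "additive K"
    unfolding additive_def
  proof (intro allI impI)
    fix U V assume UV: "U \<subseteq> cpts K" "V \<subseteq> cpts K"
    have "cop K {a} {b} = \<delta> a b" if "a \<in> U" "b \<in> V" for a b
      using that UV by (auto simp: op delta_op_def)
    then show "cop K U V = delta_op (\<lambda>a b. cop K {a} {b}) U V"
      using UV by (simp add: op[of U V] delta_op_def)
  qed
next
  assume add: "additive K"
  note B = convergent_cover_basic[OF K]
  let ?S = "cpts K" and ?I = "\<lambda>a. {U. cov (cover K) a U}" and ?C = "\<lambda>a U. U"
    and ?d = "\<lambda>a b. cop K {a} {b}"
  have op: "delta_op ?d U V = cop K U V" if "U \<subseteq> ?S" "V \<subseteq> ?S" for U V
    using add that by (simp add: additive_def)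
  have conv: "conv_D ?d ?C a j \<subseteq> ?S \<and> cov (cover K) a (conv_D ?d ?C a j)"
    if "j \<in> conv_J ?S ?d ?I a" for a j
  proof -
    from that consider (orig) U where "j = Orig U" "cov (cover K) a U"
      | (comm) b c where "j = CommAx b c" "b \<in> ?S" "c \<in> ?S" "a \<in> cop K {b} {c}"
      | (assoc) b c d where "j = AssocAx b c d" "b \<in> ?S" "c \<in> ?S" "d \<in> ?S"
          "a \<in> delta_op ?d (cop K {b} {c}) {d}"
      unfolding conv_J_def by blast
    then show ?thesis
    proof cases
      case orig then show ?thesis using cov_pts[OF B] by simp
    next
      case comm then show ?thesis
        using cop_comm[OF K, of "{b}" "{c}"] cop_pts[OF K] by (simp add: set_cov_def)
    next
      case assoc
      then have "a \<in> cop K (cop K {b} {c}) {d}" using op[OF cop_pts[OF K]] by simp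
      then show ?thesis
        using assoc cop_assoc[OF K, of "{b}" "{c}" "{d}"] op[OF _ cop_pts[OF K]] cop_pts[OF K]
        by (simp add: set_cov_def)
    qed
  qed
  have stab: "stab_D ?d (conv_D ?d ?C) a k \<subseteq> ?S \<and> cov (cover K) a (stab_D ?d (conv_D ?d ?C) a k)"
    if "k \<in> stab_J ?S ?d (conv_J ?S ?d ?I) a" for a k
  proof -
    from that consider (base) j where "k = Base j" "j \<in> conv_J ?S ?d ?I a"
      | (stab) b c j where "k = StabAx b c j" "b \<in> ?S" "c \<in> ?S" "a \<in> cop K {b} {c}"
          "j \<in> conv_J ?S ?d ?I b"
      unfolding stab_J_def by blast
    then show ?thesis
    proof cases
      case base then show ?thesis using conv by simp
    next
      case stab
      note b = conv[OF stab(5)]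
      have "set_cov (cover K) {b} (conv_D ?d ?C b j)" "set_cov (cover K) {c} {c}"
        using b stab cov_refl[OF B, of "{c}" c] by (simp_all add: set_cov_def)
      from cop_set_cov[OF K this] show ?thesis
        using stab b op[of "conv_D ?d ?C b j" "{c}"] cop_pts[OF K] by (simp add: set_cov_def)
    qed
  qed
  let ?gen = "gen_cov ?S (stab_J ?S ?d (conv_J ?S ?d ?I)) (stab_D ?d (conv_D ?d ?C))"
  have "?gen a U \<longleftrightarrow> cov (cover K) a U" for a U
  proof
    assume "?gen a U"
    from gen_cov_least[OF B HOL.refl stab this] show "cov (cover K) a U" .
  next
    assume U: "cov (cover K) a U"
    show "?gen a U"
      \<comment> \<open>One step with the axiom \<open>a \<lhd> U\<close>, which is among the original axioms.\<close>
      by (rule gen_cov.infinity[where i = "Base (Orig U)"])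
        (use U cov_pts[OF B U] in \<open>simp_all add: gen_cov.refl stab_J_def conv_J_def\<close>)
  qed
  then have "cover K = gen_cover ?S (stab_J ?S ?d (conv_J ?S ?d ?I)) (stab_D ?d (conv_D ?d ?C))"
    by (intro bcov.equality) (simp_all add: gen_cover_def fun_eq_iff)
  moreover have "cop K U V = (if U \<subseteq> ?S \<and> V \<subseteq> ?S then delta_op ?d U V else {})" for U V
    using op cop_outside[OF K] by simp
  ultimately have "K = gen_conv_cover ?S ?I ?C ?d"
    by (intro ccov.equality) (simp_all add: gen_conv_cover_def fun_eq_iff)
  moreover have "axiom_set ?S ?I ?C" using cov_pts[OF B] by (auto simp: axiom_set_def)
  ultimately show "inductively_generated_cc K"
    using cop_pts[OF K] unfolding inductively_generated_cc_def by (intro exI conjI ballI)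
qed

section \<open>Convergent covers as co-semigroups\<close>

text \<open>
  The comultiplication with \<open>\<mu>\<^sup>- (a, b) = a \<circ> b\<close>.
\<close>

definition comult :: "'a elem ccov \<Rightarrow> ('a elem \<times> 'a elem) set set" where
  "comult K = mor (cover K) (tensor (cover K) (cover K)) (on_pairs (\<lambda>a b. cop K {a} {b}))"

text \<open>
  The operation with \<open>{a} \<circ> {b} = \<mu>\<^sup>- (a, b)\<close>, extended to subsets by unions. Its values need
  not be saturated, as a union of saturated sets is not saturated in general.
\<close>

definition ccov_of :: "'a elem bcov \<Rightarrow> ('a elem \<times> 'a elem) set set \<Rightarrow> 'a elem ccov" where
  "ccov_of X \<mu> = \<lparr>cover = X, cop = (\<lambda>U V. if U \<subseteq> pts X \<and> V \<subseteq> pts X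
     then delta_op (\<lambda>a b. pre X \<mu> {Pr a b}) U V else {})\<rparr>"

context
  fixes K :: "'a elem ccov"
  assumes K: "convergent_cover K" and add: "additive K"
begin

private lemmas B = convergent_cover_basic[OF K]

lemma sat_cop_cong:
  assumes "sat (cover K) U = sat (cover K) U'" "sat (cover K) V = sat (cover K) V'"
    and sub: "U \<subseteq> cpts K" "U' \<subseteq> cpts K" "V \<subseteq> cpts K" "V' \<subseteq> cpts K"
  shows "sat (cover K) (cop K U V) = sat (cover K) (cop K U' V')"
proof -
  have "set_cov (cover K) U U'" "set_cov (cover K) U' U" "set_cov (cover K) V V'" "set_cov (cover K) V' V"
    using assms(1,2) sub[THEN sat_self[OF B]] sub by (simp_all add: set_cov_iff_sat[OF B])
  then have "set_cov (cover K) (cop K U V) (cop K U' V')" "set_cov (cover K) (cop K U' V') (cop K U V)"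
    by (simp_all add: cop_set_cov[OF K])
  then show ?thesis
    by (intro sat_eqI[OF B _ _ cop_pts[OF K] cop_pts[OF K]]) (simp_all add: set_cov_iff_sat[OF B cop_pts[OF K]])
qed

lemma sat_cop_sat:
  assumes "U \<subseteq> cpts K" "V \<subseteq> cpts K"
  shows "sat (cover K) (cop K (sat (cover K) U) (sat (cover K) V)) = sat (cover K) (cop K U V)"
  by (rule sat_cop_cong[OF sat_sat[OF B assms(1)] sat_sat[OF B assms(2)] sat_pts assms(1) sat_pts assms(2)])

lemma sat_cop_comm:
  assumes "U \<subseteq> cpts K" "V \<subseteq> cpts K"
  shows "sat (cover K) (cop K U V) = sat (cover K) (cop K V U)"
  using cop_comm[OF K assms] cop_comm[OF K assms(2,1)]
  by (intro sat_eqI[OF B _ _ cop_pts[OF K] cop_pts[OF K]]) (simp_all add: set_cov_iff_sat[OF B cop_pts[OF K]])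

text \<open>
  Only one inclusion is an axiom; commutativity turns it into the other one, by reversing the
  bracketing.
\<close>

lemma sat_cop_assoc:
  assumes U: "U \<subseteq> cpts K" and V: "V \<subseteq> cpts K" and W: "W \<subseteq> cpts K"
  shows "sat (cover K) (cop K (cop K U V) W) = sat (cover K) (cop K U (cop K V W))"
proof
  let ?A = "sat (cover K)"
  note cp = cop_pts[OF K]
  have le: "?A (cop K (cop K U V) W) \<subseteq> ?A (cop K U (cop K V W))"
    if "U \<subseteq> cpts K" "V \<subseteq> cpts K" "W \<subseteq> cpts K" for U V W
    using cop_assoc[OF K that] by (intro sat_subset_sat[OF B cp]) (simp add: set_cov_iff_sat[OF B cp])
  show "?A (cop K (cop K U V) W) \<subseteq> ?A (cop K U (cop K V W))" by (rule le[OF U V W])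
  have "?A (cop K U (cop K V W)) = ?A (cop K (cop K V W) U)" by (rule sat_cop_comm[OF U cp])
  also have "\<dots> = ?A (cop K (cop K W V) U)"
    by (rule sat_cop_cong[OF sat_cop_comm[OF V W] HOL.refl cp cp U U])
  also have "\<dots> \<subseteq> ?A (cop K W (cop K V U))" by (rule le[OF W V U])
  also have "\<dots> = ?A (cop K (cop K V U) W)" by (rule sat_cop_comm[OF W cp])
  also have "\<dots> = ?A (cop K (cop K U V) W)"
    by (rule sat_cop_cong[OF sat_cop_comm[OF V U] HOL.refl cp cp W W])
  finally show "?A (cop K U (cop K V W)) \<subseteq> ?A (cop K (cop K U V) W)" .
qed

lemma preserves_covers_cop:
  "preserves_covers (cover K) (tensor (cover K) (cover K)) (on_pairs (\<lambda>a b. cop K {a} {b}))"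
proof (rule preserves_covers_tensorI[OF B B B]; unfold on_pairs_Pr preserves_covers_def;
    intro conjI ballI allI impI cop_pts[OF K])
  fix a b V assume b: "b \<in> cpts K" and aV: "cov (cover K) a V"
  have V: "V \<subseteq> cpts K" using cov_pts[OF B aV] by simp
  have "set_cov (cover K) (cop K {a} {b}) (cop K V {b})"
    using b aV cov_pts[OF B aV] cov_refl[OF B, of "{b}" b] by (intro cop_set_cov[OF K]) (simp_all add: set_cov_def)
  moreover have "cop K V {b} = (\<Union>a\<in>V. cop K {a} {b})"
    using cop_UN_left[OF add, of "{b}" V "\<lambda>a. {a}"] b V by auto
  ultimately show "cop K {a} {b} \<subseteq> sat (cover K) (\<Union>a\<in>V. cop K {a} {b})"
    using set_cov_iff_sat[OF B cop_pts[OF K]] by metis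
next
  fix a b V assume a: "a \<in> cpts K" and bV: "cov (cover K) b V"
  have V: "V \<subseteq> cpts K" using cov_pts[OF B bV] by simp
  have "set_cov (cover K) (cop K {a} {b}) (cop K {a} V)"
    using a bV cov_pts[OF B bV] cov_refl[OF B, of "{a}" a] by (intro cop_set_cov[OF K]) (simp_all add: set_cov_def)
  moreover have "cop K {a} V = (\<Union>b\<in>V. cop K {a} {b})"
    using cop_UN_right[OF add, of "{a}" V "\<lambda>b. {b}"] a V by auto
  ultimately show "cop K {a} {b} \<subseteq> sat (cover K) (\<Union>b\<in>V. cop K {a} {b})"
    using set_cov_iff_sat[OF B cop_pts[OF K]] by metis
qed

lemma comult_hom: "comult K \<in> bc_hom (cover K) (tensor (cover K) (cover K))"
  unfolding comult_def by (intro mor_in_hom B basic_cover_tensor preserves_covers_cop)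

lemma pre_comult:
  assumes U: "U \<subseteq> cpts K" and V: "V \<subseteq> cpts K"
  shows "pre (cover K) (comult K) (pairs U V) = sat (cover K) (cop K U V)"
proof -
  have "pre (cover K) (comult K) (pairs U V) = sat (cover K) (\<Union>a\<in>U. \<Union>b\<in>V. cop K {a} {b})"
    using pre_mor[OF B basic_cover_tensor[OF B B] preserves_covers_cop, of "pairs U V"] pairs_mono[OF U V]
    by (simp add: comult_def UN_pairs pts_tensor[OF B B])
  then show ?thesis using add U V by (simp add: additive_def delta_op_def)
qed

lemma comm_cosemigroup_comult: "comm_cosemigroup BCov_i (cover K) (comult K)"
proof -
  let ?A = "sat (cover K)" and ?m = "pre (cover K) (comult K)"
  have m: "?m {Pr a b} = ?A (cop K {a} {b})" if "a \<in> cpts K" "b \<in> cpts K" for a b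
    using pre_comult[of "{a}" "{b}"] that by simp
  have "?m (pairs {a} (?m {Pr b c})) = ?m (pairs (?m {Pr a b}) {c})"
    if abc: "a \<in> cpts K" "b \<in> cpts K" "c \<in> cpts K" for a b c
  proof -
    have "?m (pairs {a} (?m {Pr b c})) = ?A (cop K {a} (?A (cop K {b} {c})))"
      using abc by (simp add: m pre_comult sat_pts)
    also have "\<dots> = ?A (cop K {a} (cop K {b} {c}))"
      using abc by (intro sat_cop_cong sat_sat[OF B] sat_pts cop_pts[OF K] HOL.refl) simp_all
    also have "\<dots> = ?A (cop K (cop K {a} {b}) {c})"
      using abc by (intro sat_cop_assoc[symmetric]) simp_all
    also have "\<dots> = ?A (cop K (?A (cop K {a} {b})) {c})"
      using abc by (intro sat_cop_cong sat_sat[OF B, symmetric] sat_pts cop_pts[OF K] HOL.refl) simp_all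
    also have "\<dots> = ?m (pairs (?m {Pr a b}) {c})"
      using abc by (simp add: m pre_comult sat_pts)
    finally show ?thesis .
  qed
  moreover have "?m {Pr b a} = ?m {Pr a b}" if "a \<in> cpts K" "b \<in> cpts K" for a b
    using that sat_cop_comm[of "{a}" "{b}"] by (simp add: m)
  ultimately show ?thesis
    using B comult_hom unfolding comm_cosemigroup_iff by blast
qed

end

context
  fixes K L :: "'a elem ccov"
  assumes K: "convergent_cover K" "additive K" and L: "convergent_cover L" "additive L"
begin

private lemmas BK = convergent_cover_basic[OF K(1)] and BL = convergent_cover_basic[OF L(1)]

lemma cc_maps_class_iff:
  "R \<in> cc_maps K L // bc_eq (cover K) (cover L) \<longleftrightarrow> R \<in> bc_hom (cover K) (cover L) \<and>
    (\<forall>b1\<in>cpts L. \<forall>b2\<in>cpts L.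
      pre (cover K) R (cop L {b1} {b2}) = sat (cover K) (cop K (pre (cover K) R {b1}) (pre (cover K) R {b2})))"
proof -
  let ?P = "\<lambda>R. \<forall>b1\<in>cpts L. \<forall>b2\<in>cpts L.
      pre (cover K) R (cop L {b1} {b2}) = sat (cover K) (cop K (pre (cover K) R {b1}) (pre (cover K) R {b2}))"
  have rep: "r \<in> cc_maps K L \<longleftrightarrow> ?P R"
    if R: "R \<in> bc_hom (cover K) (cover L)" and r: "r \<in> R" for R r
  proof -
    note maps = bc_hom_mem[OF R r]
    have "pre (cover K) R (cop L {b1} {b2}) = sat (cover K) (r\<inverse> `` cop L {b1} {b2})" for b1 b2
      by (rule pre_eq_representative[OF BK R r cop_pts[OF L(1)]])
    moreover have "sat (cover K) (cop K (pre (cover K) R {b1}) (pre (cover K) R {b2})) =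
        sat (cover K) (cop K (r\<inverse> `` {b1}) (r\<inverse> `` {b2}))" if "b1 \<in> cpts L" "b2 \<in> cpts L" for b1 b2
      using that pre_eq_representative[OF BK R r, of "{_}"]
      by (simp add: sat_cop_sat[OF K bc_maps_sub[OF maps] bc_maps_sub[OF maps]])
    ultimately show ?thesis using maps by (simp add: cc_maps_def)
  qed
  show ?thesis
  proof
    assume "R \<in> cc_maps K L // bc_eq (cover K) (cover L)"
    then obtain r where r: "r \<in> cc_maps K L" "R = bc_eq (cover K) (cover L) `` {r}" by (rule quotientE)
    then have "r \<in> bc_maps (cover K) (cover L)" by (simp add: cc_maps_def)
    then have "R \<in> bc_hom (cover K) (cover L)" "r \<in> R"
      using r(2) equiv_class_self[OF equiv_bc_eq] by (simp_all add: bc_hom_def quotientI)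
    then show "R \<in> bc_hom (cover K) (cover L) \<and> ?P R" using rep r(1) by simp
  next
    assume R: "R \<in> bc_hom (cover K) (cover L) \<and> ?P R"
    then obtain r where r: "r \<in> R" "R = bc_eq (cover K) (cover L) `` {r}" using bc_homE by metis
    then have "r \<in> cc_maps K L" using rep R by blast
    then show "R \<in> cc_maps K L // bc_eq (cover K) (cover L)" unfolding r(2) by (rule quotientI)
  qed
qed

text \<open>
  The two sides of \<open>\<mu>' \<cdot> r = (r \<otimes> r) \<cdot> \<mu>\<close> at \<open>(b\<^sub>1, b\<^sub>2)\<close> are \<open>r\<^sup>- (b\<^sub>1 \<circ> b\<^sub>2)\<close> and \<open>r\<^sup>- b\<^sub>1 \<circ> r\<^sup>- b\<^sub>2\<close>.
\<close>

lemma cc_maps_class_iff_cosemigroup_map: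
  "R \<in> cc_maps K L // bc_eq (cover K) (cover L) \<longleftrightarrow>
    cosemigroup_map BCov_i (cover K) (comult K) (cover L) (comult L) R"
proof -
  have "pre (cover K) R (pre (cover L) (comult L) {Pr b1 b2}) = pre (cover K) R (cop L {b1} {b2})"
    if "R \<in> bc_hom (cover K) (cover L)" "b1 \<in> cpts L" "b2 \<in> cpts L" for b1 b2
    using that pre_comult[OF L, of "{b1}" "{b2}"] pre_sat[OF BK BL that(1) cop_pts[OF L(1)]] by simp
  then show ?thesis
    unfolding cc_maps_class_iff cosemigroup_map_iff[OF BK comult_hom[OF K] BL comult_hom[OF L]]
      pre_comult[OF K pre_pts pre_pts]
    by auto
qed

text \<open>
  Closure of convergent cover maps under composition needs their defining equation for subsets, as
  the inverse image of a point is a subset; the equation of co-semigroup morphisms supplies it.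
\<close>

lemma pre_cop:
  assumes "R \<in> cc_maps K L // bc_eq (cover K) (cover L)" and V: "V1 \<subseteq> cpts L" "V2 \<subseteq> cpts L"
  shows "pre (cover K) R (cop L V1 V2) = sat (cover K) (cop K (pre (cover K) R V1) (pre (cover K) R V2))"
proof -
  have R: "R \<in> bc_hom (cover K) (cover L)" using assms(1) cc_maps_class_iff by blast
  show ?thesis
    using cosemigroup_mapD[OF BK comult_hom[OF K] BL comult_hom[OF L] _ V, of R] assms(1)
    by (simp add: cc_maps_class_iff_cosemigroup_map pre_comult[OF L V] pre_comult[OF K pre_pts pre_pts]
        pre_sat[OF BK BL R cop_pts[OF L(1)]])
qed

end

lemma CBCov_i_Ob: "K \<in> Ob CBCov_i \<longleftrightarrow> convergent_cover K \<and> additive K"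
  using inductively_generated_cc_iff_additive by (auto simp: CBCov_i_def)

lemma is_category_CBCov_i: "is_category (CBCov_i :: ('a elem ccov, ('a elem \<times> 'a elem) set set) category)"
proof -
  let ?C = "CBCov_i :: ('a elem ccov, ('a elem \<times> 'a elem) set set) category"
  have Hom: "R \<in> Hom ?C K L \<longleftrightarrow> R \<in> cc_maps K L // bc_eq (cover K) (cover L)" for R K L
    by (simp add: CBCov_i_def)
  have hom: "R \<in> bc_hom (cover K) (cover L)"
    if "K \<in> Ob ?C" "L \<in> Ob ?C" "R \<in> Hom ?C K L" for R K L
    using that by (simp add: CBCov_i_Ob Hom cc_maps_class_iff)
  have B: "basic_cover (cover K)" if "K \<in> Ob ?C" for K
    using that by (simp add: CBCov_i_Ob convergent_cover_basic)
  have "Idm ?C K \<in> Hom ?C K K" if K: "K \<in> Ob ?C" for K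
  proof -
    note K' = K[unfolded CBCov_i_Ob, THEN conjunct1] K[unfolded CBCov_i_Ob, THEN conjunct2]
    show ?thesis
      unfolding Hom cc_maps_class_iff[OF K' K']
      by (simp add: CBCov_i_def bc_id_hom[OF B[OF K]] cop_pts[OF K'(1)] sat_cop_sat[OF K'])
  qed
  moreover have "Comp ?C K L M g f \<in> Hom ?C K M"
    if K: "K \<in> Ob ?C" and L: "L \<in> Ob ?C" and M: "M \<in> Ob ?C"
      and f: "f \<in> Hom ?C K L" and g: "g \<in> Hom ?C L M"
    for K L M f g
  proof -
    note K' = K[unfolded CBCov_i_Ob, THEN conjunct1] K[unfolded CBCov_i_Ob, THEN conjunct2]
      and L' = L[unfolded CBCov_i_Ob, THEN conjunct1] L[unfolded CBCov_i_Ob, THEN conjunct2]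
      and M' = M[unfolded CBCov_i_Ob, THEN conjunct1] M[unfolded CBCov_i_Ob, THEN conjunct2]
    note gf = bc_comp_hom[OF B[OF K] B[OF L] hom[OF K L f] hom[OF L M g]]
    show ?thesis
      unfolding Hom cc_maps_class_iff[OF K' M']
      by (simp add: CBCov_i_def gf cop_pts[OF M'(1)] pre_cop[OF L' M' g[unfolded Hom]]
          pre_sat[OF B[OF K] B[OF L] hom[OF K L f] cop_pts[OF L'(1)]]
          pre_cop[OF K' L' f[unfolded Hom] pre_pts pre_pts])
  qed
  moreover have "Comp ?C K K L f (Idm ?C K) = f" "Comp ?C K L L (Idm ?C L) f = f"
    if "K \<in> Ob ?C" "L \<in> Ob ?C" "f \<in> Hom ?C K L" for K L f
    using bc_comp_id[OF B[OF that(1)] B[OF that(2)] hom[OF that]] by (simp_all add: CBCov_i_def)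
  moreover have "Comp ?C K M N h (Comp ?C K L M g f) = Comp ?C K L N (Comp ?C L M N h g) f"
    if "K \<in> Ob ?C" "L \<in> Ob ?C" "M \<in> Ob ?C" "N \<in> Ob ?C"
      "f \<in> Hom ?C K L" "g \<in> Hom ?C L M" "h \<in> Hom ?C M N"
    for K L M N f g h
    using bc_comp_assoc[OF B[OF that(1)] B[OF that(2)] B[OF that(3)]
      hom[OF that(1,2,5)] hom[OF that(2,3,6)] hom[OF that(3,4,7)]]
    by (simp add: CBCov_i_def)
  ultimately show ?thesis unfolding is_category_def by (intro conjI ballI)
qed

section \<open>Co-semigroups as convergent covers\<close>

context
  fixes X :: "'a elem bcov" and \<mu>
  assumes cosem: "comm_cosemigroup BCov_i X \<mu>"
begin

private lemma X: "basic_cover X" and mu: "\<mu> \<in> bc_hom X (tensor X X)"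
  and coassoc: "a \<in> pts X \<Longrightarrow> b \<in> pts X \<Longrightarrow> c \<in> pts X \<Longrightarrow>
    pre X \<mu> (pairs {a} (pre X \<mu> {Pr b c})) = pre X \<mu> (pairs (pre X \<mu> {Pr a b}) {c})"
  and cocomm: "a \<in> pts X \<Longrightarrow> b \<in> pts X \<Longrightarrow> pre X \<mu> {Pr b a} = pre X \<mu> {Pr a b}"
  using cosem unfolding comm_cosemigroup_iff by blast+

private abbreviation "K \<equiv> ccov_of X \<mu>"

lemma cover_ccov_of: "cover K = X"
  by (simp add: ccov_of_def)

lemma cop_ccov_of_singletons: "a \<in> pts X \<Longrightarrow> b \<in> pts X \<Longrightarrow> cop K {a} {b} = pre X \<mu> {Pr a b}"
  by (simp add: ccov_of_def delta_op_def)

lemma mem_cop_ccov_of: "x \<in> cop K U V \<longleftrightarrow>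
    U \<subseteq> pts X \<and> V \<subseteq> pts X \<and> (\<exists>a\<in>U. \<exists>b\<in>V. x \<in> pre X \<mu> {Pr a b})"
  by (auto simp: ccov_of_def delta_op_def)

lemma cop_ccov_of_pts: "cop K U V \<subseteq> pts X"
  using subsetD[OF pre_pts[of X \<mu>]] by (auto simp: mem_cop_ccov_of)

lemma sat_cop_ccov_of:
  assumes "U \<subseteq> pts X" "V \<subseteq> pts X"
  shows "sat X (cop K U V) = pre X \<mu> (pairs U V)"
  using pre_UN[OF X mu, of "pairs U V"] pairs_mono[OF assms] assms
  by (simp add: ccov_of_def delta_op_def UN_pairs pts_tensor[OF X X])

lemma additive_ccov_of: "additive K"
  unfolding additive_def
proof (intro allI impI)
  fix U V assume UV: "U \<subseteq> cpts K" "V \<subseteq> cpts K"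
  have "delta_op (\<lambda>a b. cop K {a} {b}) U V = (\<Union>a\<in>U. \<Union>b\<in>V. pre X \<mu> {Pr a b})"
    unfolding delta_op_def
    by (intro SUP_cong HOL.refl cop_ccov_of_singletons) (use UV in \<open>auto simp: cover_ccov_of\<close>)
  then show "cop K U V = delta_op (\<lambda>a b. cop K {a} {b}) U V"
    using UV by (simp add: ccov_of_def delta_op_def)
qed

lemma convergent_ccov_of: "convergent_cover K"
proof (rule convergent_coverI[OF _ additive_ccov_of]; (unfold cover_ccov_of)?)
  note ten = basic_cover_tensor[OF X X]
  show "basic_cover X" by (rule X)
  show "cop K U V \<subseteq> pts X" for U V by (rule cop_ccov_of_pts)
  show "\<not> (U \<subseteq> pts X \<and> V \<subseteq> pts X) \<Longrightarrow> cop K U V = {}" for U V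
    unfolding ccov_of_def by (simp only: ccov.simps if_False)
  show "set_cov X (cop K U1 U2) (cop K V1 V2)"
    if "set_cov X U1 V1" "set_cov X U2 V2" for U1 V1 U2 V2
  proof -
    from that have U: "U1 \<subseteq> pts X" "U2 \<subseteq> pts X" and V: "V1 \<subseteq> pts X" "V2 \<subseteq> pts X"
      by (simp_all add: set_cov_def)
    with that have "U1 \<subseteq> sat X V1" "U2 \<subseteq> sat X V2" by (simp_all add: set_cov_iff_sat[OF X])
    then have "pairs U1 U2 \<subseteq> sat (tensor X X) (pairs V1 V2)"
      by (rule subset_trans[OF pairs_mono pairs_sat_subset[OF X X V]])
    then have "pre X \<mu> (pairs U1 U2) \<subseteq> pre X \<mu> (pairs V1 V2)"
      using pairs_mono[OF V] by (intro pre_subset_pre[OF X ten mu]) (simp_all add: pts_tensor[OF X X])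
    then show ?thesis
      using sat_self[OF X cop_ccov_of_pts[of U1 U2]]
      by (simp add: set_cov_iff_sat[OF X cop_ccov_of_pts] sat_cop_ccov_of U V)
  qed
  show "set_cov X (cop K (cop K U V) W) (cop K U (cop K V W))"
    if U: "U \<subseteq> pts X" and V: "V \<subseteq> pts X" and W: "W \<subseteq> pts X" for U V W
    unfolding set_cov_iff_sat[OF X cop_ccov_of_pts]
  proof
    fix x assume "x \<in> cop K (cop K U V) W"
    then obtain u v w y where uvw: "u \<in> U" "v \<in> V" "w \<in> W"
      and y: "y \<in> pre X \<mu> {Pr u v}" and x: "x \<in> pre X \<mu> {Pr y w}"
      by (auto simp: mem_cop_ccov_of)
    from uvw U V W have p: "u \<in> pts X" "v \<in> pts X" "w \<in> pts X" by auto
    have "pre X \<mu> {Pr y w} \<subseteq> pre X \<mu> (pairs (pre X \<mu> {Pr u v}) {w})"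
      using y p(3) pairs_mono[OF pre_pts, of "{w}" "pts X" X \<mu> "{Pr u v}"]
      by (intro pre_mono[OF X ten mu]) (simp_all add: pts_tensor[OF X X])
    also have "\<dots> = pre X \<mu> (pairs {u} (pre X \<mu> {Pr v w}))"
      by (rule coassoc[OF p, symmetric])
    also have "\<dots> \<subseteq> pre X \<mu> (pairs U (cop K V W))"
    proof (rule pre_mono[OF X ten mu])
      have "pre X \<mu> {Pr v w} \<subseteq> cop K V W"
        by (rule subsetI, rule iffD2[OF mem_cop_ccov_of])
          (intro conjI V W bexI[OF bexI[OF _ uvw(3)] uvw(2)])
      then show "pairs {u} (pre X \<mu> {Pr v w}) \<subseteq> pairs U (cop K V W)"
        using uvw(1) by (intro pairs_mono) simp_all
      show "pairs U (cop K V W) \<subseteq> pts (tensor X X)"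
        using pairs_mono[OF U cop_ccov_of_pts] by (simp add: pts_tensor[OF X X])
    qed
    also have "\<dots> = sat X (cop K U (cop K V W))"
      by (rule sat_cop_ccov_of[OF U cop_ccov_of_pts, symmetric])
    finally show "x \<in> sat X (cop K U (cop K V W))" using x by blast
  qed
  show "set_cov X (cop K U V) (cop K V U)" if U: "U \<subseteq> pts X" and V: "V \<subseteq> pts X" for U V
  proof -
    have "pre X \<mu> {Pr b a} = pre X \<mu> {Pr a b}" if "a \<in> U" "b \<in> V" for a b
      using that U V by (intro cocomm) auto
    then have "cop K U V \<subseteq> cop K V U" using U V by (fastforce simp: mem_cop_ccov_of)
    then show ?thesis
      using sat_self[OF X cop_ccov_of_pts] by (simp add: set_cov_iff_sat[OF X cop_ccov_of_pts] subset_trans)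
  qed
qed

lemma comult_ccov_of: "comult K = \<mu>"
proof -
  have "comult K = mor X (tensor X X) (\<lambda>x. pre X \<mu> {x})"
    unfolding comult_def cover_ccov_of
    by (rule mor_cong) (auto simp: pts_tensor[OF X X] pairs_def cop_ccov_of_singletons)
  then show ?thesis using bc_hom_eq_mor[OF X mu] by simp
qed

end

theorem proposition4p17:
  shows "equivalent_categories
    (CBCov_i :: ('a elem ccov, ('a elem \<times> 'a elem) set set) category)
    (comm_cosemigroups (BCov_i :: ('a elem bcov, ('a elem \<times> 'a elem) set set) sym_monoidal_category))"
    (is "equivalent_categories ?C ?D")
proof (rule equivalence_identity_on_arrows[
      where F = "\<lambda>K. (cover K, comult K)" and G = "\<lambda>(X, \<mu>). ccov_of X \<mu>"])
  show "is_category ?C" by (rule is_category_CBCov_i)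
  show "(cover K, comult K) \<in> Ob ?D" if "K \<in> Ob ?C" for K
    using that by (simp add: CBCov_i_Ob comm_cosemigroups_def comm_cosemigroup_comult)
  show "Hom ?D (cover K, comult K) (cover L, comult L) = Hom ?C K L" if "K \<in> Ob ?C" "L \<in> Ob ?C" for K L
  proof -
    have "Hom ?C K L = {R. R \<in> cc_maps K L // bc_eq (cover K) (cover L)}" by (simp add: CBCov_i_def)
    also have "\<dots> = {R. cosemigroup_map BCov_i (cover K) (comult K) (cover L) (comult L) R}"
      using that by (simp only: CBCov_i_Ob cc_maps_class_iff_cosemigroup_map)
    finally show ?thesis by (simp add: comm_cosemigroups_def)
  qed
  fix Y assume "Y \<in> Ob ?D"
  then obtain X \<mu> where Y: "Y = (X, \<mu>)" "comm_cosemigroup BCov_i X \<mu>"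
    by (auto simp: comm_cosemigroups_def)
  show "(case Y of (X, \<mu>) \<Rightarrow> ccov_of X \<mu>) \<in> Ob ?C"
    using convergent_ccov_of[OF Y(2)] additive_ccov_of[OF Y(2)] by (simp add: Y(1) CBCov_i_Ob)
  show "(cover (case Y of (X, \<mu>) \<Rightarrow> ccov_of X \<mu>), comult (case Y of (X, \<mu>) \<Rightarrow> ccov_of X \<mu>)) = Y"
    using cover_ccov_of[OF Y(2)] comult_ccov_of[OF Y(2)] by (simp add: Y(1))
qed (simp_all add: CBCov_i_def comm_cosemigroups_def BCov_i_def)

end
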